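(* Let $M$ be a finite-dimensional $\mathbf{U}$-module. Then $M$, regarded as a $\mathbf{U}^{\imath}$-module by restriction, belongs to the category $\mathcal{C}'$.
   Context: Base field. $\mathbb{K}$ is an algebraic closure of $\mathbb{C}(q)$, regarded (Puiseux) as a subfield of $\bigcup_{n\ge 1}\mathbb{C}((q^{1/n}))$; $\mathbb{K}_1\subset\mathbb{K}$ is the subring of elements admitting an expansion $\sum_{m\ge 0}a_m(q^{1/n}-1)^m$ ($a_m\in\mathbb{C}$) for some $n\ge1$; $\overline{\,\cdot\,}:\mathbb{K}_1\to\mathbb{C}$ is the ring homomorphism sending such an element to $a_0$ (classical limit, evaluation at $q=1$). Notation: $[x,y]=xy-yx$, $[z;n]_{q^a}=\frac{q^{an}z-q^{-an}z^{-1}}{q^a-q^{-a}}$, $(x;n)_{q^a}=\frac{q^{an}x-1}{q^a-1}$. Satake diagram $(I,I_\bullet,\tau)$: $I$ is the Dynkin diagram of a complex semisimple Lie algebra $\mathfrak g$ (Cartan subalgebra $\mathfrak h$, Cartan matrix $(a_{i,j})$, simple roots $\alpha_i$, simple coroots $h_i$, root lattice $Q$, $q_i=q^{d_i}$ where $d_i$ are the symmetrizing integers, $d_ia_{i,j}=d_ja_{j,i}$), $I_\bullet\subset I$, $I_\circ=I\setminus I_\bullet$, $\tau$ an involutive diagram automorphism preserving $I_\bullet$, such that $w_\bullet(\alpha_i)=-\alpha_{\tau(i)}$ for $i\in I_\bullet$ ($w_\bullet$ = longest element of the Weyl group of $I_\bullet$) and $\langle\rho_\bullet^\vee,\alpha_i\rangle\in\mathbb{Z}$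 for $i\in I_\circ$ with $\tau(i)=i$ ($\rho_\bullet^\vee$ = half sum of positive coroots of $I_\bullet$). $\mathbf U=U_q(\mathfrak g)$ is the quantum group over $\mathbb{K}$ with generators $E_i,F_i,K_i^{\pm1}$, relations $K_iE_j=q_i^{a_{i,j}}E_jK_i$, $K_iF_j=q_i^{-a_{i,j}}F_jK_i$, $[E_i,F_j]=\delta_{i,j}[K_i;0]_{q_i}$, commuting $K_i$, and the quantum Serre relations; $K_\alpha=\prod K_i^{c_i}$ for $\alpha=\sum c_i\alpha_i\in Q$. $T_i$ is Lusztig's automorphism $T''_{i,1}$: $T_i(E_i)=-F_iK_i$, $T_i(F_i)=-K_i^{-1}E_i$, $T_i(E_j)=\sum_{r+s=-a_{i,j}}(-1)^rq_i^{-r}E_i^{(s)}E_jE_i^{(r)}$, $T_i(F_j)=\sum_{r+s=-a_{i,j}}(-1)^rq_i^{r}F_i^{(r)}F_jF_i^{(s)}$ for $j\ne i$ (divided powers), $T_i(K_\alpha)=K_{s_i(\alpha)}$; $T_{w_\bullet}=T_{i_1}\cdots T_{i_p}$ for a reduced expression $w_\bullet=s_{i_1}\cdots s_{i_p}$. Parameter: $\boldsymbol\varsigma=(\varsigma_i)_{i\in I_\circ}\in(\mathbb{K}_1^\times)^{I_\circ}$ with $\varsigma_i=\varsigma_{\tau(i)}$ whenever $\langle h_i,w_\bullet(\alpha_{\tau(i)})\rangle=0$, and $\overline{\varsigma_{\tau(i)}}=(-1)^{\langle 2\rho_\bullet^\vee,\alpha_i\rangle}\overline{\varsigma_i}$.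 Set $B_i=F_i+\varsigma_iT_{w_\bullet}(E_{\tau(i)})K_i^{-1}$, $k_i=K_iK_{\tau(i)}^{-1}$ for $i\in I_\circ$, and $B_i=F_i$, $k_i=K_i$ for $i\in I_\bullet$. The $\imath$quantum group $\mathbf U^\imath$ is the subalgebra of $\mathbf U$ generated by $E_i$ ($i\in I_\bullet$), $k_i^{\pm1}$ and $B_i$ ($i\in I$). Marked vertices: $\mathfrak k=\mathfrak g^\theta$ is the symmetric subalgebra attached to the Satake diagram, $\mathfrak h^\theta=\mathfrak h\cap\mathfrak k$. By Letzter there is a set $\Gamma$ of positive roots of $\mathfrak g$ such that $\mathfrak h^\theta\oplus\bigoplus_{\gamma\in\Gamma}\mathbb{C}(f_\gamma+e_\gamma)$ is a Cartan subalgebra of $\mathfrak k$ for suitable root vectors $e_\gamma\in\mathfrak g_\gamma,f_\gamma\in\mathfrak g_{-\gamma}$; $\Gamma$ is fixed (Letzter's choice) and $I_\otimes=\{i\in I\mid\alpha_i\in\Gamma\}$. It satisfies: $\tau(i)=i$ for $i\in I_\otimes$; $a_{i,j}=0$ for $i\ne j$ in $I_\otimes$; $a_{i,j}=0$ for $i\in I_\bullet$, $j\in I_\otimes$. $\mathbf U^\imath(\mathfrak t')$ is the (commutative) subalgebra of $\mathbf U^\imath$ generated by all $k_i^{\pm1}$ ($i\in I$) and $B_j$ ($j\in I_\otimes$). A $\mathbf U^\imath$-module $M$ is a classical weight module if $\mathbf U^\imath(\mathfrak t')$ acts semisimply (simultaneously diagonalizably) with eigenvalues of $(k_i;0)_{q_i}$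 ($i\in I\setminus I_\otimes$) and $B_j$ ($j\in I_\otimes$) all in $\mathbb{K}_1$. $\mathcal C$ is the category of classical weight modules, and $\mathcal C'\subset\mathcal C$ the full subcategory of those whose simultaneous eigenspaces for $\mathbf U^\imath(\mathfrak t')$ are all finite-dimensional.
   Formalization: The finite-dimensional U-module M is assumed to be of type 1 (eigenvalues of each K_i are integer powers of q_i); without this the claim fails, e.g. for I_• = I and the one-dimensional module with K_i = -1, E_i = F_i = 0. *)

theory Defs
  imports
    "HOL-Algebra.Algebraic_Closure_Type"
    "HOL-Algebra.Generated_Rings"
    "HOL-Algebra.QuotRing"
    "HOL-Library.Poly_Mapping"
begin

section \<open>The base field and the classical limit\<close>

type_synonym K = "complex poly fract alg_closure"

definition const_K :: "complex \<Rightarrow> K" where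
  "const_K c = to_ac (to_fract [:c:])"

definition q :: K where
  "q = to_ac (to_fract [:0, 1:])"

text \<open>
  Expansions at \<open>q = 1\<close> are taken in an algebraic closure of the field of formal Laurent series
  in \<open>t = q - 1\<close>; by Puiseux's theorem this closure is \<open>\<Union>\<^sub>n \<complex>((t\<^bsup>1/n\<^esup>))\<close>.  A branch of all
  algebraic functions of \<open>q\<close> near \<open>q = 1\<close> is an embedding of \<open>K\<close> over \<open>\<complex>(q)\<close>.
\<close>

definition expansion_at_one :: "(K \<Rightarrow> complex fls alg_closure) \<Rightarrow> bool" where
  "expansion_at_one \<Phi> \<longleftrightarrow>
     (\<forall>x y. \<Phi> (x + y) = \<Phi> x + \<Phi> y) \<and> (\<forall>x y. \<Phi> (x * y) = \<Phi> x * \<Phi> y) \<and>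
     (\<forall>c. \<Phi> (const_K c) = to_ac (fls_const c)) \<and> \<Phi> q = to_ac (1 + fls_X)"

text \<open>
  \<open>q\<^bsup>1/n\<^esup>\<close> is the branch with value \<open>1\<close> at \<open>q = 1\<close>, that is, the binomial series
  \<open>(1 + t)\<^bsup>1/n\<^esup>\<close>, and \<open>a oo (fps_binomial (1/n) - 1)\<close> is \<open>\<Sum>m. a\<^sub>m (q\<^bsup>1/n\<^esup> - 1)\<^sup>m\<close>.
\<close>

definition has_expansion :: "(K \<Rightarrow> complex fls alg_closure) \<Rightarrow> K \<Rightarrow> nat \<Rightarrow> complex fps \<Rightarrow> bool" where
  "has_expansion \<Phi> x n a \<longleftrightarrow>
     \<Phi> x = to_ac (fps_to_fls (a oo (fps_binomial (1 / of_nat n) - 1)))"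

definition K1 :: "(K \<Rightarrow> complex fls alg_closure) \<Rightarrow> K set" where
  "K1 \<Phi> = {x. \<exists>n\<ge>1. \<exists>a. has_expansion \<Phi> x n a}"

definition K1_units :: "(K \<Rightarrow> complex fls alg_closure) \<Rightarrow> K set" where
  "K1_units \<Phi> = {x \<in> K1 \<Phi>. \<exists>y\<in>K1 \<Phi>. x * y = 1}"

definition classical_limit :: "(K \<Rightarrow> complex fls alg_closure) \<Rightarrow> K \<Rightarrow> complex" where
  "classical_limit \<Phi> x = (THE c. \<exists>n\<ge>1. \<exists>a. has_expansion \<Phi> x n a \<and> c = fps_nth a 0)"


section \<open>Cartan matrices, Weyl groups and Satake diagrams\<close>

text \<open>
  The vertex set \<open>I\<close> is a finite type.  Elements of the root lattice and of the coroot lattice are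
  their coefficient functions with respect to the simple roots, respectively the simple coroots.
\<close>

definition symmetrizer :: "('i \<Rightarrow> 'i \<Rightarrow> int) \<Rightarrow> ('i \<Rightarrow> nat) \<Rightarrow> bool" where
  "symmetrizer a d \<longleftrightarrow> (\<forall>i. d i > 0) \<and> (\<forall>i j. int (d i) * a i j = int (d j) * a j i)"

text \<open>
  The minimality condition normalizes \<open>d\<close> to be coprime on every connected component.
\<close>

definition cartan_matrix :: "('i::finite \<Rightarrow> 'i \<Rightarrow> int) \<Rightarrow> ('i \<Rightarrow> nat) \<Rightarrow> bool" where
  "cartan_matrix a d \<longleftrightarrow>
     (\<forall>i. a i i = 2) \<and> (\<forall>i j. i \<noteq> j \<longrightarrow> a i j \<le> 0) \<and>
     symmetrizer a d \<and> (\<forall>d'. symmetrizer a d' \<longrightarrow> (\<forall>i. d i \<le> d' i)) \<and>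
     (\<forall>x :: 'i \<Rightarrow> real. (\<exists>i. x i \<noteq> 0) \<longrightarrow>
        (\<Sum>i\<in>UNIV. \<Sum>j\<in>UNIV. real (d i) * real_of_int (a i j) * x i * x j) > 0)"

definition simple :: "'i \<Rightarrow> 'i \<Rightarrow> int" where
  "simple i = (\<lambda>j. if j = i then 1 else 0)"

definition pairing :: "('i::finite \<Rightarrow> 'i \<Rightarrow> int) \<Rightarrow> 'i \<Rightarrow> ('i \<Rightarrow> int) \<Rightarrow> int" where
  "pairing a i \<beta> = (\<Sum>j\<in>UNIV. a i j * \<beta> j)"

definition reflection :: "('i::finite \<Rightarrow> 'i \<Rightarrow> int) \<Rightarrow> 'i \<Rightarrow> ('i \<Rightarrow> int) \<Rightarrow> ('i \<Rightarrow> int)" where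
  "reflection a i \<beta> = (\<lambda>j. \<beta> j - pairing a i \<beta> * simple i j)"

definition weyl :: "('i::finite \<Rightarrow> 'i \<Rightarrow> int) \<Rightarrow> 'i list \<Rightarrow> ('i \<Rightarrow> int) \<Rightarrow> ('i \<Rightarrow> int)" where
  "weyl a ws = foldr (reflection a) ws"

definition reduced :: "('i::finite \<Rightarrow> 'i \<Rightarrow> int) \<Rightarrow> 'i list \<Rightarrow> bool" where
  "reduced a ws \<longleftrightarrow> (\<forall>vs. weyl a vs = weyl a ws \<longrightarrow> length ws \<le> length vs)"

text \<open>
  \<open>ws\<close> is a reduced expression of the longest element of the Weyl group of \<open>J\<close>.
\<close>

definition longest_word :: "('i::finite \<Rightarrow> 'i \<Rightarrow> int) \<Rightarrow> 'i set \<Rightarrow> 'i list \<Rightarrow> bool" where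
  "longest_word a J ws \<longleftrightarrow> set ws \<subseteq> J \<and> reduced a ws \<and>
     (\<forall>vs. set vs \<subseteq> J \<and> reduced a vs \<longrightarrow> length vs \<le> length ws)"

text \<open>
  With \<open>a i j = \<langle>h\<^sub>i, \<alpha>\<^sub>j\<rangle>\<close>, the Weyl group acts on the coroot lattice by
  \<open>s\<^sub>i(h) = h - \<langle>h, \<alpha>\<^sub>i\<rangle> h\<^sub>i\<close>, which is the action on the root lattice of the transposed matrix.
\<close>

abbreviation transposed :: "('i \<Rightarrow> 'i \<Rightarrow> int) \<Rightarrow> 'i \<Rightarrow> 'i \<Rightarrow> int" where
  "transposed a \<equiv> \<lambda>i j. a j i"

definition positive_coroots :: "('i::finite \<Rightarrow> 'i \<Rightarrow> int) \<Rightarrow> 'i set \<Rightarrow> ('i \<Rightarrow> int) set" where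
  "positive_coroots a J =
     {\<gamma>. (\<forall>k. \<gamma> k \<ge> 0) \<and> (\<exists>ws. \<exists>j\<in>J. set ws \<subseteq> J \<and> \<gamma> = weyl (transposed a) ws (simple j))}"

text \<open>\<open>two_rho a J i\<close> is \<open>\<langle>2\<rho>\<^sup>\<or>, \<alpha>\<^sub>i\<rangle>\<close>, where \<open>2\<rho>\<^sup>\<or>\<close> is the sum of the positive coroots of \<open>J\<close>.\<close>

definition two_rho :: "('i::finite \<Rightarrow> 'i \<Rightarrow> int) \<Rightarrow> 'i set \<Rightarrow> 'i \<Rightarrow> int" where
  "two_rho a J i = (\<Sum>\<gamma>\<in>positive_coroots a J. pairing (transposed a) i \<gamma>)"

text \<open>
  In the following, \<open>J\<close> is the set of black vertices and \<open>ws\<close> a reduced expression of \<open>w\<^sub>\<bullet>\<close>.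
\<close>

definition satake_diagram ::
  "('i::finite \<Rightarrow> 'i \<Rightarrow> int) \<Rightarrow> 'i set \<Rightarrow> ('i \<Rightarrow> 'i) \<Rightarrow> 'i list \<Rightarrow> bool" where
  "satake_diagram a J \<tau> ws \<longleftrightarrow>
     longest_word a J ws \<and>
     (\<forall>i. \<tau> (\<tau> i) = i) \<and> (\<forall>i j. a (\<tau> i) (\<tau> j) = a i j) \<and> \<tau> ` J = J \<and>
     (\<forall>i\<in>J. weyl a ws (simple i) = (\<lambda>k. - simple (\<tau> i) k)) \<and>
     (\<forall>i. i \<notin> J \<and> \<tau> i = i \<longrightarrow> (of_int (two_rho a J i) / 2 :: rat) \<in> \<int>)"

definition parameter ::
  "('i::finite \<Rightarrow> 'i \<Rightarrow> int) \<Rightarrow> 'i set \<Rightarrow> ('i \<Rightarrow> 'i) \<Rightarrow> 'i list \<Rightarrow>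
   (K \<Rightarrow> complex fls alg_closure) \<Rightarrow> ('i \<Rightarrow> K) \<Rightarrow> bool" where
  "parameter a J \<tau> ws \<Phi> \<sigma> \<longleftrightarrow> (\<forall>i. i \<notin> J \<longrightarrow>
     \<sigma> i \<in> K1_units \<Phi> \<and>
     (pairing a i (weyl a ws (simple (\<tau> i))) = 0 \<longrightarrow> \<sigma> i = \<sigma> (\<tau> i)) \<and>
     classical_limit \<Phi> (\<sigma> (\<tau> i)) = (- 1) powi two_rho a J i * classical_limit \<Phi> (\<sigma> i))"


section \<open>The symmetric pair and the marked vertices\<close>

definition finite_dim :: "('k::field \<Rightarrow> 'v::ab_group_add \<Rightarrow> 'v) \<Rightarrow> 'v set \<Rightarrow> bool" where
  "finite_dim s V \<longleftrightarrow> (\<exists>B. finite B \<and> V \<subseteq> Modules.module.span s B)"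

definition lie_algebra ::
  "(complex \<Rightarrow> 'g::ab_group_add \<Rightarrow> 'g) \<Rightarrow> ('g \<Rightarrow> 'g \<Rightarrow> 'g) \<Rightarrow> bool" where
  "lie_algebra s br \<longleftrightarrow>
     vector_space s \<and>
     (\<forall>x. Vector_Spaces.linear s s (br x)) \<and> (\<forall>y. Vector_Spaces.linear s s (\<lambda>x. br x y)) \<and>
     (\<forall>x. br x x = 0) \<and>
     (\<forall>x y z. br x (br y z) + br y (br z x) + br z (br x y) = 0)"

definition lie_subalgebra ::
  "(complex \<Rightarrow> 'g::ab_group_add \<Rightarrow> 'g) \<Rightarrow> ('g \<Rightarrow> 'g \<Rightarrow> 'g) \<Rightarrow> 'g set \<Rightarrow> bool" where
  "lie_subalgebra s br L \<longleftrightarrow> Modules.module.subspace s L \<and> (\<forall>x\<in>L. \<forall>y\<in>L. br x y \<in> L)"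

text \<open>
  A finite-dimensional Lie algebra is semisimple if and only if it has no nonzero abelian ideal.
\<close>

definition semisimple_lie_algebra ::
  "(complex \<Rightarrow> 'g::ab_group_add \<Rightarrow> 'g) \<Rightarrow> ('g \<Rightarrow> 'g \<Rightarrow> 'g) \<Rightarrow> bool" where
  "semisimple_lie_algebra s br \<longleftrightarrow>
     lie_algebra s br \<and> finite_dim s UNIV \<and>
     (\<forall>A. Modules.module.subspace s A \<and> (\<forall>x. \<forall>y\<in>A. br x y \<in> A) \<and> (\<forall>x\<in>A. \<forall>y\<in>A. br x y = 0)
        \<longrightarrow> A = {0})"

definition chevalley_generators ::
  "('i::finite \<Rightarrow> 'i \<Rightarrow> int) \<Rightarrow> (complex \<Rightarrow> 'g::ab_group_add \<Rightarrow> 'g) \<Rightarrow> ('g \<Rightarrow> 'g \<Rightarrow> 'g) \<Rightarrow>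
   ('i \<Rightarrow> 'g) \<Rightarrow> ('i \<Rightarrow> 'g) \<Rightarrow> ('i \<Rightarrow> 'g) \<Rightarrow> bool" where
  "chevalley_generators a s br e f h \<longleftrightarrow>
     inj h \<and> \<not> Modules.module.dependent s (range h) \<and>
     (\<forall>i j. br (h i) (h j) = 0) \<and>
     (\<forall>i j. br (h i) (e j) = s (of_int (a i j)) (e j)) \<and>
     (\<forall>i j. br (h i) (f j) = s (of_int (- a i j)) (f j)) \<and>
     (\<forall>i j. br (e i) (f j) = (if i = j then h i else 0)) \<and>
     (\<forall>L. lie_subalgebra s br L \<and> range e \<subseteq> L \<and> range f \<subseteq> L \<longrightarrow> L = UNIV)"

definition root_space ::
  "('i::finite \<Rightarrow> 'i \<Rightarrow> int) \<Rightarrow> (complex \<Rightarrow> 'g::ab_group_add \<Rightarrow> 'g) \<Rightarrow> ('g \<Rightarrow> 'g \<Rightarrow> 'g) \<Rightarrow>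
   ('i \<Rightarrow> 'g) \<Rightarrow> ('i \<Rightarrow> int) \<Rightarrow> 'g set" where
  "root_space a s br h \<beta> = {x. \<forall>i. br (h i) x = s (of_int (pairing a i \<beta>)) x}"

definition positive_roots ::
  "('i::finite \<Rightarrow> 'i \<Rightarrow> int) \<Rightarrow> (complex \<Rightarrow> 'g::ab_group_add \<Rightarrow> 'g) \<Rightarrow> ('g \<Rightarrow> 'g \<Rightarrow> 'g) \<Rightarrow>
   ('i \<Rightarrow> 'g) \<Rightarrow> ('i \<Rightarrow> int) set" where
  "positive_roots a s br h =
     {\<beta>. (\<forall>k. \<beta> k \<ge> 0) \<and> (\<exists>k. \<beta> k \<noteq> 0) \<and> root_space a s br h \<beta> \<noteq> {0}}"

text \<open>
  The involutions attached to a Satake diagram: \<open>\<theta>\<close> fixes the black Chevalley generators and acts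
  on the Cartan subalgebra by \<open>- w\<^sub>\<bullet> \<tau>\<close>.  Two of them are conjugate under the torus.
\<close>

definition satake_involution ::
  "('i::finite \<Rightarrow> 'i \<Rightarrow> int) \<Rightarrow> 'i set \<Rightarrow> ('i \<Rightarrow> 'i) \<Rightarrow> 'i list \<Rightarrow>
   (complex \<Rightarrow> 'g::ab_group_add \<Rightarrow> 'g) \<Rightarrow> ('g \<Rightarrow> 'g \<Rightarrow> 'g) \<Rightarrow>
   ('i \<Rightarrow> 'g) \<Rightarrow> ('i \<Rightarrow> 'g) \<Rightarrow> ('i \<Rightarrow> 'g) \<Rightarrow> ('g \<Rightarrow> 'g) \<Rightarrow> bool" where
  "satake_involution a J \<tau> ws s br e f h \<theta> \<longleftrightarrow>
     Vector_Spaces.linear s s \<theta> \<and> (\<forall>x y. \<theta> (br x y) = br (\<theta> x) (\<theta> y)) \<and> (\<forall>x. \<theta> (\<theta> x) = x) \<and>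
     (\<forall>i\<in>J. \<theta> (e i) = e i \<and> \<theta> (f i) = f i) \<and>
     (\<forall>i. \<theta> (h i) =
        - (\<Sum>k\<in>UNIV. s (of_int (weyl (transposed a) ws (simple (\<tau> i)) k)) (h k)))"

definition fixed_points :: "('g \<Rightarrow> 'g) \<Rightarrow> 'g set" where
  "fixed_points \<theta> = {x. \<theta> x = x}"

text \<open>A Cartan subalgebra of \<open>L\<close> is a nilpotent subalgebra that is self-normalizing in \<open>L\<close>.\<close>

definition cartan_subalgebra ::
  "(complex \<Rightarrow> 'g::ab_group_add \<Rightarrow> 'g) \<Rightarrow> ('g \<Rightarrow> 'g \<Rightarrow> 'g) \<Rightarrow> 'g set \<Rightarrow> 'g set \<Rightarrow> bool" where
  "cartan_subalgebra s br L H \<longleftrightarrow>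
     H \<subseteq> L \<and> lie_subalgebra s br H \<and>
     (\<exists>n. \<forall>xs. length xs = n \<and> set xs \<subseteq> H \<longrightarrow> (\<forall>y\<in>H. foldr br xs y = 0)) \<and>
     {x\<in>L. \<forall>y\<in>H. br x y \<in> H} = H"

text \<open>
  The span in the following definition is the direct sum of \<open>h\<^sup>\<theta>\<close> and the lines
  \<open>\<complex>(f\<^sub>\<gamma> + e\<^sub>\<gamma>)\<close>, because nonzero vectors of distinct weights are linearly independent.
\<close>

definition marking_roots ::
  "('i::finite \<Rightarrow> 'i \<Rightarrow> int) \<Rightarrow> (complex \<Rightarrow> 'g::ab_group_add \<Rightarrow> 'g) \<Rightarrow> ('g \<Rightarrow> 'g \<Rightarrow> 'g) \<Rightarrow>
   ('i \<Rightarrow> 'g) \<Rightarrow> ('g \<Rightarrow> 'g) \<Rightarrow> ('i \<Rightarrow> int) set \<Rightarrow> bool" where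
  "marking_roots a s br h \<theta> \<Gamma> \<longleftrightarrow>
     \<Gamma> \<subseteq> positive_roots a s br h \<and>
     (\<exists>ev fv. (\<forall>\<gamma>\<in>\<Gamma>. ev \<gamma> \<in> root_space a s br h \<gamma> - {0} \<and>
                       fv \<gamma> \<in> root_space a s br h (\<lambda>k. - \<gamma> k) - {0}) \<and>
       cartan_subalgebra s br (fixed_points \<theta>)
         (Modules.module.span s
            ((Modules.module.span s (range h) \<inter> fixed_points \<theta>) \<union> (\<lambda>\<gamma>. fv \<gamma> + ev \<gamma>) ` \<Gamma>)))"

definition marked_vertices :: "('i \<Rightarrow> int) set \<Rightarrow> 'i set" where
  "marked_vertices \<Gamma> = {i. simple i \<in> \<Gamma>}"

definition admissible_marking ::
  "('i \<Rightarrow> 'i \<Rightarrow> int) \<Rightarrow> 'i set \<Rightarrow> ('i \<Rightarrow> 'i) \<Rightarrow> 'i set \<Rightarrow> bool" where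
  "admissible_marking a J \<tau> S \<longleftrightarrow>
     (\<forall>i\<in>S. \<tau> i = i) \<and> (\<forall>i\<in>S. \<forall>j\<in>S. i \<noteq> j \<longrightarrow> a i j = 0) \<and> (\<forall>i\<in>J. \<forall>j\<in>S. a i j = 0)"


section \<open>The free algebra on the generators\<close>

datatype 'i gen = GE 'i | GF 'i | GK 'i | GKinv 'i

text \<open>
  The free monoid is a copy of the lists, which carry no instance of \<^class>\<open>monoid_add\<close>; the free
  algebra is its monoid algebra with the convolution product of \<^type>\<open>poly_mapping\<close>.
\<close>

datatype 'a free_monoid = Word (letters: "'a list")

instantiation free_monoid :: (type) monoid_add
begin

definition zero_free_monoid :: "'a free_monoid" where
  "0 = Word []"

definition plus_free_monoid :: "'a free_monoid \<Rightarrow> 'a free_monoid \<Rightarrow> 'a free_monoid" where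
  "u + v = Word (letters u @ letters v)"

instance
  by standard (simp_all add: zero_free_monoid_def plus_free_monoid_def)

end

type_synonym 'i free_alg = "'i gen free_monoid \<Rightarrow>\<^sub>0 K"

definition scal :: "K \<Rightarrow> 'i free_alg" where
  "scal c = Poly_Mapping.single 0 c"

definition gvar :: "'i gen \<Rightarrow> 'i free_alg" where
  "gvar g = Poly_Mapping.single (Word [g]) 1"

abbreviation "E i \<equiv> gvar (GE i)"
abbreviation "F i \<equiv> gvar (GF i)"
abbreviation "Ki i \<equiv> gvar (GK i)"
abbreviation "Kinv i \<equiv> gvar (GKinv i)"

definition subst :: "('i gen \<Rightarrow> 'i free_alg) \<Rightarrow> 'i free_alg \<Rightarrow> 'i free_alg" where
  "subst \<phi> x =
     (\<Sum>w\<in>Poly_Mapping.keys x. scal (Poly_Mapping.lookup x w) * prod_list (map \<phi> (letters w)))"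

definition Kpow :: "'i \<Rightarrow> int \<Rightarrow> 'i free_alg" where
  "Kpow i n = (if n \<ge> 0 then Ki i ^ nat n else Kinv i ^ nat (- n))"

definition qint :: "K \<Rightarrow> nat \<Rightarrow> K" where
  "qint v n = (v ^ n - inverse v ^ n) / (v - inverse v)"

definition qfact :: "K \<Rightarrow> nat \<Rightarrow> K" where
  "qfact v n = (\<Prod>k=1..n. qint v k)"

definition divided_power :: "K \<Rightarrow> 'i free_alg \<Rightarrow> nat \<Rightarrow> 'i free_alg" where
  "divided_power v x n = scal (1 / qfact v n) * x ^ n"

text \<open>\<open>[z; n]\<^sub>v\<close> and \<open>(x; n)\<^sub>v\<close>; the inverse \<open>z'\<close> of \<open>z\<close> is an argument.\<close>

definition qbracket :: "K \<Rightarrow> int \<Rightarrow> 'i free_alg \<Rightarrow> 'i free_alg \<Rightarrow> 'i free_alg" where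
  "qbracket v n z z' =
     scal (1 / (v - inverse v)) * (scal (v powi n) * z - scal (v powi (- n)) * z')"

definition qshift :: "K \<Rightarrow> int \<Rightarrow> 'i free_alg \<Rightarrow> 'i free_alg" where
  "qshift v n x = scal (1 / (v - 1)) * (scal (v powi n) * x - 1)"


section \<open>The quantum group\<close>

definition serre :: "('i \<Rightarrow> 'i \<Rightarrow> int) \<Rightarrow> ('i \<Rightarrow> nat) \<Rightarrow> ('i \<Rightarrow> 'i gen) \<Rightarrow> 'i \<Rightarrow> 'i \<Rightarrow> 'i free_alg" where
  "serre a d S i j =
     (let v = q ^ d i; m = nat (1 - a i j) in
      \<Sum>r\<le>m. scal ((- 1) ^ r) *
        divided_power v (gvar (S i)) r * gvar (S j) * divided_power v (gvar (S i)) (m - r))"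

definition relators :: "('i \<Rightarrow> 'i \<Rightarrow> int) \<Rightarrow> ('i \<Rightarrow> nat) \<Rightarrow> 'i free_alg set" where
  "relators a d =
     {Ki i * Kinv i - 1 | i. True} \<union> {Kinv i * Ki i - 1 | i. True} \<union>
     {Ki i * Ki j - Ki j * Ki i | i j. True} \<union>
     {Ki i * E j - scal ((q ^ d i) powi a i j) * E j * Ki i | i j. True} \<union>
     {Ki i * F j - scal ((q ^ d i) powi (- a i j)) * F j * Ki i | i j. True} \<union>
     {E i * F j - F j * E i - (if i = j then qbracket (q ^ d i) 0 (Ki i) (Kinv i) else 0) | i j. True} \<union>
     {serre a d GE i j | i j. i \<noteq> j} \<union> {serre a d GF i j | i j. i \<noteq> j}"

definition relation_ideal :: "('i \<Rightarrow> 'i \<Rightarrow> int) \<Rightarrow> ('i \<Rightarrow> nat) \<Rightarrow> 'i free_alg set" where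
  "relation_ideal a d = Idl\<^bsub>ring_of_type_algebra\<^esub> (relators a d)"

definition quantum_group :: "('i \<Rightarrow> 'i \<Rightarrow> int) \<Rightarrow> ('i \<Rightarrow> nat) \<Rightarrow> 'i free_alg set ring" where
  "quantum_group a d = ring_of_type_algebra Quot relation_ideal a d"

definition cls :: "('i \<Rightarrow> 'i \<Rightarrow> int) \<Rightarrow> ('i \<Rightarrow> nat) \<Rightarrow> 'i free_alg \<Rightarrow> 'i free_alg set" where
  "cls a d x = relation_ideal a d +>\<^bsub>ring_of_type_algebra\<^esub> x"

text \<open>
  Lusztig's \<open>T''\<^sub>i\<^sub>,\<^sub>1\<close> on generators.  It is written as an endomorphism of the free algebra; by
  Lusztig's theorem it preserves the ideal of relations and so descends to the quantum group.
  On the generators \<open>K\<close> it is \<open>K\<^sub>\<alpha> \<mapsto> K\<^bsub>s(\<alpha>)\<^esub>\<close> with \<open>s\<^sub>i(\<alpha>\<^sub>j) = \<alpha>\<^sub>j - a\<^sub>i\<^sub>j \<alpha>\<^sub>i\<close>.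
\<close>

primrec lusztig_gen ::
  "('i \<Rightarrow> 'i \<Rightarrow> int) \<Rightarrow> ('i \<Rightarrow> nat) \<Rightarrow> 'i \<Rightarrow> 'i gen \<Rightarrow> 'i free_alg" where
  "lusztig_gen a d i (GE j) =
     (if j = i then - (F i * Ki i)
      else let v = q ^ d i; m = nat (- a i j) in
        \<Sum>r\<le>m. scal ((- 1) ^ r * inverse v ^ r) *
          divided_power v (E i) (m - r) * E j * divided_power v (E i) r)"
| "lusztig_gen a d i (GF j) =
     (if j = i then - (Kinv i * E i)
      else let v = q ^ d i; m = nat (- a i j) in
        \<Sum>r\<le>m. scal ((- 1) ^ r * v ^ r) *
          divided_power v (F i) r * F j * divided_power v (F i) (m - r))"
| "lusztig_gen a d i (GK j) = Ki j * Kpow i (- a i j)"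
| "lusztig_gen a d i (GKinv j) = Kinv j * Kpow i (a i j)"

definition lusztig ::
  "('i \<Rightarrow> 'i \<Rightarrow> int) \<Rightarrow> ('i \<Rightarrow> nat) \<Rightarrow> 'i list \<Rightarrow> 'i free_alg \<Rightarrow> 'i free_alg" where
  "lusztig a d ws = foldr (\<lambda>i. subst (lusztig_gen a d i)) ws"


section \<open>The iquantum group\<close>

definition B_gen ::
  "('i \<Rightarrow> 'i \<Rightarrow> int) \<Rightarrow> ('i \<Rightarrow> nat) \<Rightarrow> 'i set \<Rightarrow> ('i \<Rightarrow> 'i) \<Rightarrow> 'i list \<Rightarrow> ('i \<Rightarrow> K) \<Rightarrow>
   'i \<Rightarrow> 'i free_alg" where
  "B_gen a d J \<tau> ws \<sigma> i =
     (if i \<in> J then F i else F i + scal (\<sigma> i) * lusztig a d ws (E (\<tau> i)) * Kinv i)"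

definition k_gen :: "'i set \<Rightarrow> ('i \<Rightarrow> 'i) \<Rightarrow> 'i \<Rightarrow> 'i free_alg" where
  "k_gen J \<tau> i = (if i \<in> J then Ki i else Ki i * Kinv (\<tau> i))"

definition kinv_gen :: "'i set \<Rightarrow> ('i \<Rightarrow> 'i) \<Rightarrow> 'i \<Rightarrow> 'i free_alg" where
  "kinv_gen J \<tau> i = (if i \<in> J then Kinv i else Ki (\<tau> i) * Kinv i)"

text \<open>Closing up under the scalars makes the generated subring a subalgebra over \<open>K\<close>.\<close>

definition generated_subalgebra ::
  "('i \<Rightarrow> 'i \<Rightarrow> int) \<Rightarrow> ('i \<Rightarrow> nat) \<Rightarrow> 'i free_alg set \<Rightarrow> 'i free_alg set set" where
  "generated_subalgebra a d S = generate_ring (quantum_group a d) (cls a d ` (range scal \<union> S))"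

definition iquantum_group ::
  "('i \<Rightarrow> 'i \<Rightarrow> int) \<Rightarrow> ('i \<Rightarrow> nat) \<Rightarrow> 'i set \<Rightarrow> ('i \<Rightarrow> 'i) \<Rightarrow> 'i list \<Rightarrow> ('i \<Rightarrow> K) \<Rightarrow>
   'i free_alg set ring" where
  "iquantum_group a d J \<tau> ws \<sigma> =
     (quantum_group a d)\<lparr>carrier := generated_subalgebra a d
        (E ` J \<union> range (k_gen J \<tau>) \<union> range (kinv_gen J \<tau>) \<union> range (B_gen a d J \<tau> ws \<sigma>))\<rparr>"

definition torus ::
  "('i \<Rightarrow> 'i \<Rightarrow> int) \<Rightarrow> ('i \<Rightarrow> nat) \<Rightarrow> 'i set \<Rightarrow> ('i \<Rightarrow> 'i) \<Rightarrow> 'i list \<Rightarrow> ('i \<Rightarrow> K) \<Rightarrow> 'i set \<Rightarrow>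
   'i free_alg set set" where
  "torus a d J \<tau> ws \<sigma> S =
     generated_subalgebra a d
       (range (k_gen J \<tau>) \<union> range (kinv_gen J \<tau>) \<union> B_gen a d J \<tau> ws \<sigma> ` S)"


section \<open>Modules\<close>

text \<open>
  A left module over a \<open>K\<close>-algebra \<open>R\<close> with structure map \<open>\<iota> : K \<rightarrow> R\<close> is a \<open>K\<close>-vector space
  with a homomorphism of \<open>K\<close>-algebras from \<open>R\<close> to its endomorphisms.
\<close>

definition algebra_module ::
  "('u, 'b) ring_scheme \<Rightarrow> (K \<Rightarrow> 'u) \<Rightarrow> (K \<Rightarrow> 'm::ab_group_add \<Rightarrow> 'm) \<Rightarrow> ('u \<Rightarrow> 'm \<Rightarrow> 'm) \<Rightarrow> bool" where
  "algebra_module R \<iota> s act \<longleftrightarrow>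
     vector_space s \<and>
     (\<forall>u\<in>carrier R. Vector_Spaces.linear s s (act u)) \<and>
     (\<forall>u\<in>carrier R. \<forall>v\<in>carrier R. \<forall>m. act (u \<oplus>\<^bsub>R\<^esub> v) m = act u m + act v m) \<and>
     (\<forall>u\<in>carrier R. \<forall>v\<in>carrier R. \<forall>m. act (u \<otimes>\<^bsub>R\<^esub> v) m = act u (act v m)) \<and>
     (\<forall>m. act \<one>\<^bsub>R\<^esub> m = m) \<and>
     (\<forall>c m. act (\<iota> c) m = s c m)"

definition U_module ::
  "('i \<Rightarrow> 'i \<Rightarrow> int) \<Rightarrow> ('i \<Rightarrow> nat) \<Rightarrow>
   (K \<Rightarrow> 'm::ab_group_add \<Rightarrow> 'm) \<Rightarrow> ('i free_alg set \<Rightarrow> 'm \<Rightarrow> 'm) \<Rightarrow> bool" where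
  "U_module a d s act \<longleftrightarrow> algebra_module (quantum_group a d) (\<lambda>c. cls a d (scal c)) s act"

text \<open>
  Type 1: the eigenvalues of \<open>K\<^sub>i\<close> are powers of \<open>q\<^sub>i\<close>, without a sign.  (Diagonalizability of
  \<open>K\<^sub>i\<close> on finite-dimensional modules is a consequence and not part of the definition.)
\<close>

definition type_one ::
  "('i \<Rightarrow> 'i \<Rightarrow> int) \<Rightarrow> ('i \<Rightarrow> nat) \<Rightarrow>
   (K \<Rightarrow> 'm::ab_group_add \<Rightarrow> 'm) \<Rightarrow> ('i free_alg set \<Rightarrow> 'm \<Rightarrow> 'm) \<Rightarrow> bool" where
  "type_one a d s act \<longleftrightarrow>
     (\<forall>i c m. m \<noteq> 0 \<and> act (cls a d (Ki i)) m = s c m \<longrightarrow> (\<exists>n::int. c = (q ^ d i) powi n))"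

definition simultaneous_eigenspace ::
  "(K \<Rightarrow> 'm::ab_group_add \<Rightarrow> 'm) \<Rightarrow> ('u \<Rightarrow> 'm \<Rightarrow> 'm) \<Rightarrow> 'u set \<Rightarrow> ('u \<Rightarrow> K) \<Rightarrow> 'm set" where
  "simultaneous_eigenspace s act T \<chi> = {m. \<forall>x\<in>T. act x m = s (\<chi> x) m}"

definition classical_weight_module ::
  "('i \<Rightarrow> 'i \<Rightarrow> int) \<Rightarrow> ('i \<Rightarrow> nat) \<Rightarrow> 'i set \<Rightarrow> ('i \<Rightarrow> 'i) \<Rightarrow> 'i list \<Rightarrow> ('i \<Rightarrow> K) \<Rightarrow> 'i set \<Rightarrow>
   (K \<Rightarrow> complex fls alg_closure) \<Rightarrow>
   (K \<Rightarrow> 'm::ab_group_add \<Rightarrow> 'm) \<Rightarrow> ('i free_alg set \<Rightarrow> 'm \<Rightarrow> 'm) \<Rightarrow> bool" where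
  "classical_weight_module a d J \<tau> ws \<sigma> S \<Phi> s act \<longleftrightarrow>
     algebra_module (iquantum_group a d J \<tau> ws \<sigma>) (\<lambda>c. cls a d (scal c)) s act \<and>
     Modules.module.span s (\<Union>\<chi>. simultaneous_eigenspace s act (torus a d J \<tau> ws \<sigma> S) \<chi>) = UNIV \<and>
     (\<forall>i c m. i \<notin> S \<and> m \<noteq> 0 \<and> act (cls a d (qshift (q ^ d i) 0 (k_gen J \<tau> i))) m = s c m
        \<longrightarrow> c \<in> K1 \<Phi>) \<and>
     (\<forall>j c m. j \<in> S \<and> m \<noteq> 0 \<and> act (cls a d (B_gen a d J \<tau> ws \<sigma> j)) m = s c m \<longrightarrow> c \<in> K1 \<Phi>)"

text \<open>Membership of the module with action \<open>act\<close> in the category \<open>\<C>'\<close>.\<close>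

definition in_category_C' ::
  "('i \<Rightarrow> 'i \<Rightarrow> int) \<Rightarrow> ('i \<Rightarrow> nat) \<Rightarrow> 'i set \<Rightarrow> ('i \<Rightarrow> 'i) \<Rightarrow> 'i list \<Rightarrow> ('i \<Rightarrow> K) \<Rightarrow> 'i set \<Rightarrow>
   (K \<Rightarrow> complex fls alg_closure) \<Rightarrow>
   (K \<Rightarrow> 'm::ab_group_add \<Rightarrow> 'm) \<Rightarrow> ('i free_alg set \<Rightarrow> 'm \<Rightarrow> 'm) \<Rightarrow> bool" where
  "in_category_C' a d J \<tau> ws \<sigma> S \<Phi> s act \<longleftrightarrow>
     classical_weight_module a d J \<tau> ws \<sigma> S \<Phi> s act \<and>
     (\<forall>\<chi>. finite_dim s (simultaneous_eigenspace s act (torus a d J \<tau> ws \<sigma> S) \<chi>))"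

end

theory Submission
  imports Defs
begin

text \<open>
  Let \<open>M\<close> be a finite-dimensional module of type 1 over the quantum group. All simultaneous
  eigenspaces are finite-dimensional, so the point is that the torus of the iquantum group acts
  diagonalizably with eigenvalues that are regular at \<open>q = 1\<close>. Its generators \<open>k\<^sub>i\<close> and \<open>B\<^sub>j\<close> for
  marked \<open>j\<close> commute: \<open>\<tau>\<close> fixes the marked vertices, which are orthogonal to each other and to the
  black ones. It therefore suffices to diagonalize each generator separately
  (\<open>jointly_diagonalizable_finite\<close>), and each of them involves only copies of quantum sl2.

  The first task is to show that \<open>K = K\<^sub>i\<close> is diagonalizable. Since conjugation by
  \<open>K\<close> rescales \<open>E\<close> and \<open>F\<close>, and \<open>q\<close> is not a root of unity, \<open>E\<close> and \<open>F\<close> are nilpotent. Expressing \<open>E\<^sup>r F\<^sup>r\<close> and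
  \<open>F\<^sup>r E\<^sup>r\<close> through the Casimir element and \<open>K\<close> turns nilpotency into two polynomial relations
  between these commuting operators, which exclude Jordan blocks of \<open>K\<close> (\<open>K_semisimple_nonneg\<close>).
  The eigenvalues of \<open>k\<^sub>i\<close> are powers \<open>q\<^sup>m\<close>, and \<open>(q\<^sup>m - 1) / (q\<^sup>d - 1)\<close> is regular at \<open>q = 1\<close>.

  For a marked vertex \<open>j\<close> the braid group operator in \<open>B\<^sub>j\<close> fixes \<open>E\<^sub>j\<close>, so \<open>B\<^sub>j = F\<^sub>j + \<sigma>\<^sub>j E\<^sub>j K\<^sub>j\<^sup>-\<^sup>1\<close>.
  With \<open>c\<^sup>2 = \<sigma>\<^sub>j q\<^sub>j\<close>, a \<open>q\<close>-exponential \<open>W\<close> in \<open>F\<^sub>j K\<^sub>j\<close> satisfies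
  \<open>B\<^sub>j W = W (c (K\<^sub>j - K\<^sub>j\<^sup>-\<^sup>1) / (q\<^sub>j - q\<^sub>j\<^sup>-\<^sup>1) + \<sigma>\<^sub>j E\<^sub>j K\<^sub>j\<^sup>-\<^sup>1)\<close>
  (\<open>coideal_op_gauge\<close>). The operator on the right is triangular with respect to the weights, with
  the distinct scalars \<open>c [n]\<close> on the diagonal, and \<open>W\<close> is unipotent. Thus \<open>B\<^sub>j\<close> is diagonalizable
  with eigenvalues \<open>c [n]\<close> (\<open>coideal_op_diagonalizable\<close>), and \<open>c\<close> is regular at \<open>q = 1\<close> because \<open>\<sigma>\<^sub>j\<close>
  is a unit there (\<open>sqrt_in_K1\<close>).
\<close>

(* The abbreviation transposed matches every function of two arguments and would be folded again
   and again when terms are printed. *)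
declare [[show_abbrevs = false]]


section \<open>Eigenvectors and joint diagonalization\<close>

text \<open>
The locale of vector spaces is interpreted globally for real vector spaces, and every constant
declared in it would be copied there; the notions below therefore live in a locale of their own.
\<close>

locale operator_space = vector_space scale
  for scale :: "'a::field \<Rightarrow> 'b::ab_group_add \<Rightarrow> 'b" (infixr \<open>*s\<close> 75)
begin

abbreviation operator :: "('b \<Rightarrow> 'b) \<Rightarrow> bool" where
  "operator \<equiv> Vector_Spaces.linear scale scale"

lemma operator_simps:
  fixes T :: "'b \<Rightarrow> 'b" and x y :: 'b
  assumes "operator T"
  shows "T (x + y) = T x + T y" "T (x - y) = T x - T y" "T (- x) = - T x" "T 0 = 0"
    "T (c *s x) = c *s T x"
proof -
  interpret T: Vector_Spaces.linear scale scale T by (rule assms)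
  show "T (x + y) = T x + T y" "T (x - y) = T x - T y" "T (- x) = - T x" "T 0 = 0"
    "T (c *s x) = c *s T x"
    by (rule T.add T.diff T.neg T.zero T.scale)+
qed

lemma operatorI:
  assumes "\<And>x y. T (x + y) = T x + T y" "\<And>c x. T (c *s x) = c *s T x"
  shows "operator T"
  using assms vector_space_axioms by (simp add: Vector_Spaces.linear_iff)

lemma operator_sum: "operator T \<Longrightarrow> T (\<Sum>i\<in>A. g i) = (\<Sum>i\<in>A. T (g i))"
  by (induction A rule: infinite_finite_induct) (simp_all add: operator_simps)

lemma subspace_range:
  assumes "operator T"
  shows "subspace (range T)"
proof (rule subspaceI)
  have "0 = T 0" by (simp add: operator_simps[OF assms])
  then show "0 \<in> range T" by (rule range_eqI)
next
  fix x y assume "x \<in> range T" "y \<in> range T"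
  then obtain x' y' where "x = T x'" "y = T y'" by blast
  then have "x + y = T (x' + y')" by (simp add: operator_simps[OF assms])
  then show "x + y \<in> range T" by (rule range_eqI)
next
  fix c x assume "x \<in> range T"
  then obtain x' where "x = T x'" by blast
  then have "c *s x = T (c *s x')" by (simp add: operator_simps[OF assms])
  then show "c *s x \<in> range T" by (rule range_eqI)
qed

definition eigenspan :: "('b \<Rightarrow> 'b) \<Rightarrow> 'a set \<Rightarrow> 'b set" where
  "eigenspan T \<Lambda> = span {x. \<exists>c\<in>\<Lambda>. T x = c *s x}"

lemma eigenspan_base: "T x = c *s x \<Longrightarrow> c \<in> \<Lambda> \<Longrightarrow> x \<in> eigenspan T \<Lambda>"
  unfolding eigenspan_def by (rule span_base) blast

lemma eigenspan_mono: "\<Lambda> \<subseteq> \<Lambda>' \<Longrightarrow> eigenspan T \<Lambda> \<subseteq> eigenspan T \<Lambda>'"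
  unfolding eigenspan_def by (rule span_mono) blast

lemma subspace_eigenspan [simp, intro]: "subspace (eigenspan T \<Lambda>)"
  by (simp add: eigenspan_def)

lemma eigenspan_induct:
  assumes "x \<in> eigenspan T \<Lambda>" and "subspace S"
    and "\<And>y c. c \<in> \<Lambda> \<Longrightarrow> T y = c *s y \<Longrightarrow> y \<in> S"
  shows "x \<in> S"
  using assms(1) unfolding eigenspan_def
  by (rule span_subspace_induct[OF _ assms(2)]) (use assms(3) in blast)

lemma subspace_image_shift:
  assumes "operator T"
  shows "subspace {T x - c *s x | x. x \<in> eigenspan T \<Lambda>}" (is "subspace ?S")
proof (rule subspaceI)
  show "0 \<in> ?S"
    using subspace_0[OF subspace_eigenspan] operator_simps(4)[OF assms] by force
next
  fix y z assume "y \<in> ?S" "z \<in> ?S"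
  then obtain y' z' where "y' \<in> eigenspan T \<Lambda>" "z' \<in> eigenspan T \<Lambda>"
    "y = T y' - c *s y'" "z = T z' - c *s z'" by blast
  then show "y + z \<in> ?S"
    by (intro CollectI exI[of _ "y' + z'"])
      (simp add: operator_simps[OF assms] scale_right_distrib subspace_add)
next
  fix b y assume "y \<in> ?S"
  then obtain y' where "y' \<in> eigenspan T \<Lambda>" "y = T y' - c *s y'" by blast
  then show "b *s y \<in> ?S"
    by (intro CollectI exI[of _ "b *s y'"])
      (simp add: operator_simps[OF assms] scale_right_diff_distrib subspace_scale mult.commute)
qed

text \<open>
On an eigenvector with eigenvalue \<open>b \<noteq> c\<close> the operator \<open>T - c\<close> is the nonzero scalar \<open>b - c\<close>,
so it maps the span of these eigenvectors onto itself.
\<close>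

lemma eigenspan_solve:
  assumes T: "operator T" and "c \<notin> \<Lambda>" and "y \<in> eigenspan T \<Lambda>"
  obtains x where "x \<in> eigenspan T \<Lambda>" "y = T x - c *s x"
proof -
  have "y \<in> {T x - c *s x | x. x \<in> eigenspan T \<Lambda>}"
  proof (rule eigenspan_induct[OF assms(3) subspace_image_shift[OF T]])
    fix z b assume "b \<in> \<Lambda>" "T z = b *s z"
    then show "z \<in> {T x - c *s x | x. x \<in> eigenspan T \<Lambda>}"
      using assms(2) eigenspan_base[of T z b \<Lambda>]
      by (intro CollectI exI[of _ "(1 / (b - c)) *s z"] conjI subspace_scale)
        (auto simp: operator_simps[OF T] scale_left_diff_distrib[symmetric] field_simps diff_divide_distrib[symmetric])
  qed
  then show thesis using that by blast
qed

text \<open>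
This is how a triangular operator with distinct diagonal entries is diagonalized, one step of the
flag at a time: if \<open>(T - c) x = (T - c) y\<close> with \<open>y\<close> in the span, then \<open>x - y\<close> is an eigenvector
for the new eigenvalue \<open>c\<close>.
\<close>

lemma eigenspan_step:
  assumes T: "operator T" and "c \<notin> \<Lambda>" and "T x - c *s x \<in> eigenspan T \<Lambda>"
  shows "x \<in> eigenspan T (insert c \<Lambda>)"
proof -
  obtain y where y: "y \<in> eigenspan T \<Lambda>" "T x - c *s x = T y - c *s y"
    using eigenspan_solve[OF assms] by metis
  have "T (x - y) = c *s (x - y)"
    using y(2) by (simp add: operator_simps[OF T] scale_right_diff_distrib algebra_simps)
  then have "x - y \<in> eigenspan T (insert c \<Lambda>)" by (rule eigenspan_base) simp
  moreover have "y \<in> eigenspan T (insert c \<Lambda>)" using y(1) eigenspan_mono by blast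
  ultimately show ?thesis using subspace_add[OF subspace_eigenspan] by force
qed

text \<open>
Here \<open>c\<close> may occur among the eigenvalues already present. Splitting off the \<open>c\<close>-component \<open>u\<close> of
\<open>(T - c) x\<close> leaves \<open>(T - c) y\<close> with \<open>y\<close> in the span, so \<open>x - y\<close> is annihilated by \<open>(T - c)\<^sup>2\<close>.
The assumption \<open>ss\<close>, which says that such vectors are annihilated by \<open>T - c\<close>, makes it an
eigenvector.
\<close>

lemma eigenspan_semisimple_step:
  assumes T: "operator T"
    and ss: "\<And>z. T (T z - c *s z) = c *s (T z - c *s z) \<Longrightarrow> T z = c *s z"
    and "T x - c *s x \<in> eigenspan T UNIV"
  shows "x \<in> eigenspan T UNIV"
proof -
  let ?S = "{u + z | u z. T u = c *s u \<and> z \<in> eigenspan T (- {c})}"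
  have "subspace ?S"
  proof (rule subspaceI)
    show "0 \<in> ?S" using operator_simps(4)[OF T] subspace_0[OF subspace_eigenspan] by force
  next
    fix y z assume "y \<in> ?S" "z \<in> ?S"
    then obtain u u' w w' where "T u = c *s u" "T u' = c *s u'" "w \<in> eigenspan T (- {c})"
      "w' \<in> eigenspan T (- {c})" "y = u + w" "z = u' + w'" by blast
    then show "y + z \<in> ?S"
      by (intro CollectI exI[of _ "u + u'"] exI[of _ "w + w'"])
        (simp add: operator_simps[OF T] scale_right_distrib subspace_add)
  next
    fix b y assume "y \<in> ?S"
    then obtain u w where "T u = c *s u" "w \<in> eigenspan T (- {c})" "y = u + w" by blast
    then show "b *s y \<in> ?S"
      by (intro CollectI exI[of _ "b *s u"] exI[of _ "b *s w"])
        (simp add: operator_simps[OF T] scale_right_distrib subspace_scale mult.commute)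
  qed
  then have "T x - c *s x \<in> ?S"
  proof (rule eigenspan_induct[OF assms(3)])
    fix y b assume y: "T y = b *s y"
    show "y \<in> ?S"
    proof (cases "b = c")
      case True
      then show ?thesis using y subspace_0[OF subspace_eigenspan, of T "- {c}"] by force
    next
      case False
      then have "y \<in> eigenspan T (- {c})" using y by (intro eigenspan_base) auto
      then show ?thesis using operator_simps(4)[OF T] by force
    qed
  qed
  then obtain u z where uz: "T u = c *s u" "z \<in> eigenspan T (- {c})" "T x - c *s x = u + z"
    by blast
  obtain y where y: "y \<in> eigenspan T (- {c})" "z = T y - c *s y"
    using eigenspan_solve[OF T _ uz(2), of c] by blast
  have u: "T (x - y) - c *s (x - y) = u"
    using uz(3) y(2) by (simp add: operator_simps[OF T] scale_right_diff_distrib algebra_simps)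
  have "T (x - y) = c *s (x - y)" by (rule ss) (simp only: u uz(1))
  then have "x - y \<in> eigenspan T UNIV" by (rule eigenspan_base) simp
  moreover have "y \<in> eigenspan T UNIV" using y(1) eigenspan_mono[of "- {c}" UNIV T] by blast
  ultimately show ?thesis using subspace_add[OF subspace_eigenspan] by force
qed

text \<open>
The components are indexed by their eigenvalues, so that distinct components belong to distinct
eigenvalues.
\<close>

lemma eigenspan_decompose:
  assumes T: "operator T" and "x \<in> eigenspan T \<Lambda>"
  obtains R w where "finite R" "R \<subseteq> \<Lambda>" "x = (\<Sum>r\<in>R. w r)" "\<And>r. T (w r) = r *s w r"
proof -
  let ?S = "{\<Sum>r\<in>R. w r | R w. finite R \<and> R \<subseteq> \<Lambda> \<and> (\<forall>r. T (w r) = r *s w r)}"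
  have "subspace ?S"
  proof (rule subspaceI)
    show "0 \<in> ?S"
      by (intro CollectI exI[of _ "{}"] exI[of _ "\<lambda>_. 0"]) (simp add: operator_simps[OF T])
  next
    fix y z assume "y \<in> ?S" "z \<in> ?S"
    then obtain R w R' w' where *: "finite R" "R \<subseteq> \<Lambda>" "\<forall>r. T (w r) = r *s w r" "y = sum w R"
      "finite R'" "R' \<subseteq> \<Lambda>" "\<forall>r. T (w' r) = r *s w' r" "z = sum w' R'" by blast
    let ?w = "\<lambda>r. (if r \<in> R then w r else 0) + (if r \<in> R' then w' r else 0)"
    have "sum ?w (R \<union> R') = y + z"
      using *(1,5) by (simp add: sum.distrib sum.If_cases *(4,8) Int_absorb1)
    moreover have "T (?w r) = r *s ?w r" for r
      using *(3,7) by (simp add: operator_simps[OF T] scale_right_distrib)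
    ultimately show "y + z \<in> ?S"
      using *(1,2,5,6) by (intro CollectI exI[of _ "R \<union> R'"] exI[of _ ?w]) simp
  next
    fix b y assume "y \<in> ?S"
    then obtain R w where *: "finite R" "R \<subseteq> \<Lambda>" "\<forall>r. T (w r) = r *s w r" "y = sum w R"
      by blast
    then show "b *s y \<in> ?S"
      by (intro CollectI exI[of _ R] exI[of _ "\<lambda>r. b *s w r"])
        (simp add: operator_simps[OF T] scale_sum_right mult.commute)
  qed
  moreover have "y \<in> ?S" if "c \<in> \<Lambda>" "T y = c *s y" for y c
    by (intro CollectI exI[of _ "{c}"] exI[of _ "\<lambda>r. if r = c then y else 0"])
      (use that in \<open>simp add: operator_simps[OF T]\<close>)
  ultimately have "x \<in> ?S" using eigenspan_induct[OF assms(2)] by blast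
  then show thesis using that by blast
qed

text \<open>
Applying \<open>T - c\<close> to the sum removes the component of \<open>c\<close> and rescales the others by nonzero
factors, which gives an induction on the number of components.
\<close>

lemma eigencomponents_in_invariant_subspace:
  assumes T: "operator T" and V: "subspace V" "\<And>x. x \<in> V \<Longrightarrow> T x \<in> V"
    and "finite R" and "\<And>r. T (w r) = r *s w r" and "(\<Sum>r\<in>R. w r) \<in> V"
  shows "\<forall>r\<in>R. w r \<in> V"
  using assms(4-6)
proof (induction R arbitrary: w rule: finite_induct)
  case empty
  then show ?case by simp
next
  case (insert c R)
  let ?x = "\<Sum>r\<in>insert c R. w r"
  have "T ?x - c *s ?x = (\<Sum>r\<in>R. (r - c) *s w r)"
    using insert.hyps
    by (simp add: operator_simps[OF T] operator_sum[OF T] insert.prems(1) scale_right_distrib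
        scale_sum_right scale_left_diff_distrib sum_subtractf)
  moreover have "T ?x - c *s ?x \<in> V"
    by (intro subspace_diff subspace_scale V insert.prems(2))
  ultimately have "(\<Sum>r\<in>R. (r - c) *s w r) \<in> V" by simp
  then have *: "\<forall>r\<in>R. (r - c) *s w r \<in> V"
    by (intro insert.IH) (simp_all add: operator_simps[OF T] insert.prems(1) mult.commute)
  have R: "w r \<in> V" if "r \<in> R" for r
  proof -
    have "(1 / (r - c)) *s ((r - c) *s w r) \<in> V"
      by (rule subspace_scale[OF V(1)]) (use * that in blast)
    moreover have "r \<noteq> c" using that insert.hyps by blast
    ultimately show ?thesis by simp
  qed
  then have "?x - (\<Sum>r\<in>R. w r) \<in> V"
    by (intro subspace_diff[OF V(1) insert.prems(2)] subspace_sum V(1))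
  then have "w c \<in> V" using insert.hyps by simp
  then show ?case using R by blast
qed

text \<open>
If \<open>c\<close> were not in \<open>\<Lambda>\<close>, then \<open>(T - c) x = 0\<close> would lie in the invariant subspace \<open>{0}\<close>, hence so
would all its components, which are nonzero multiples of the components of \<open>x\<close>.
\<close>

lemma eigenvalue_of_eigenspan:
  assumes T: "operator T" and "eigenspan T \<Lambda> = UNIV" and x: "T x = c *s x" "x \<noteq> 0"
  shows "c \<in> \<Lambda>"
proof (rule ccontr)
  assume c: "c \<notin> \<Lambda>"
  obtain R w where R: "finite R" "R \<subseteq> \<Lambda>" "x = (\<Sum>r\<in>R. w r)" "\<And>r. T (w r) = r *s w r"
    using eigenspan_decompose[OF T, of x \<Lambda>] assms(2) by blast
  have "(\<Sum>r\<in>R. (r - c) *s w r) = T x - c *s x"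
    using R(1) by (simp add: R(3,4) operator_sum[OF T] scale_sum_right scale_left_diff_distrib sum_subtractf)
  then have "(\<Sum>r\<in>R. (r - c) *s w r) \<in> {0}" using x(1) by simp
  then have "\<forall>r\<in>R. (r - c) *s w r \<in> {0}"
    by (intro eigencomponents_in_invariant_subspace[OF T _ _ R(1)])
      (simp_all add: operator_simps[OF T] R(4) mult.commute)
  then have "\<forall>r\<in>R. w r = 0" using c R(2) by auto
  then show False using R(3) x(2) by simp
qed

definition jointly_diagonalizable :: "('b \<Rightarrow> 'b) set \<Rightarrow> bool" where
  "jointly_diagonalizable \<T> \<longleftrightarrow> span {x. \<forall>T\<in>\<T>. \<exists>c. T x = c *s x} = UNIV"

text \<open>
The joint eigenspace of \<open>\<T>\<close> through a joint eigenvector \<open>y\<close> is stable under \<open>T\<close>, because \<open>T\<close>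
commutes with \<open>\<T>\<close>. So it contains the \<open>T\<close>-components of \<open>y\<close>, which are then joint eigenvectors
of the larger family.
\<close>

lemma jointly_diagonalizable_insert:
  assumes T: "operator T" and diag: "eigenspan T UNIV = UNIV"
    and ops: "\<And>S. S \<in> \<T> \<Longrightarrow> operator S" and "jointly_diagonalizable \<T>"
    and comm: "\<And>S x. S \<in> \<T> \<Longrightarrow> S (T x) = T (S x)"
  shows "jointly_diagonalizable (insert T \<T>)"
proof -
  let ?J = "{x. \<forall>S\<in>insert T \<T>. \<exists>c. S x = c *s x}"
  have "x \<in> span ?J" for x
  proof (rule span_subspace_induct[of x "{x. \<forall>S\<in>\<T>. \<exists>c. S x = c *s x}" "span ?J"])
    show "x \<in> span {x. \<forall>S\<in>\<T>. \<exists>c. S x = c *s x}"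
      using assms(4) by (simp add: jointly_diagonalizable_def)
  next
    fix y assume "y \<in> {x. \<forall>S\<in>\<T>. \<exists>c. S x = c *s x}"
    then obtain \<chi> where \<chi>: "\<And>S. S \<in> \<T> \<Longrightarrow> S y = \<chi> S *s y" by (auto dest!: bchoice)
    let ?V = "{z. \<forall>S\<in>\<T>. S z = \<chi> S *s z}"
    obtain R w where R: "finite R" "y = (\<Sum>r\<in>R. w r)" "\<And>r. T (w r) = r *s w r"
      using eigenspan_decompose[OF T, of y UNIV] diag by blast
    have "subspace ?V"
      by (rule subspaceI) (auto simp: operator_simps ops scale_right_distrib mult.commute)
    then have "\<forall>r\<in>R. w r \<in> ?V"
      by (rule eigencomponents_in_invariant_subspace[OF T _ _ R(1,3)])
        (use \<chi> R(2) in \<open>auto simp: comm operator_simps[OF T]\<close>)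
    then have "\<forall>r\<in>R. w r \<in> ?J" using R(3) by blast
    then show "y \<in> span ?J" unfolding R(2) by (intro span_sum span_base) blast
  qed simp
  then show ?thesis by (auto simp: jointly_diagonalizable_def)
qed

lemma jointly_diagonalizable_finite:
  assumes "finite \<T>" and "\<And>T. T \<in> \<T> \<Longrightarrow> operator T" and "\<And>T. T \<in> \<T> \<Longrightarrow> eigenspan T UNIV = UNIV"
    and "\<And>S T x. S \<in> \<T> \<Longrightarrow> T \<in> \<T> \<Longrightarrow> S (T x) = T (S x)"
  shows "jointly_diagonalizable \<T>"
  using assms
proof (induction \<T> rule: finite_induct)
  case empty
  then show ?case by (simp add: jointly_diagonalizable_def)
next
  case (insert T \<T>)
  then show ?case by (intro jointly_diagonalizable_insert) auto
qed

end


section \<open>Products of linear factors in finite dimension\<close>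

context operator_space
begin

definition root_product :: "('b \<Rightarrow> 'b) \<Rightarrow> 'a list \<Rightarrow> 'b \<Rightarrow> 'b" where
  "root_product T cs = foldr (\<lambda>c y. T y - c *s y) cs"

lemma root_product_simps [simp]:
  "root_product T [] x = x"
  "root_product T (c # cs) x = T (root_product T cs x) - c *s root_product T cs x"
  "root_product T (cs @ ds) x = root_product T cs (root_product T ds x)"
  by (simp_all add: root_product_def)

lemma root_product_intertwine:
  assumes "operator S" and "\<And>x. T (S x) = S (T' x)"
  shows "root_product T cs (S x) = S (root_product T' cs x)"
  by (induction cs) (simp_all add: assms(2) operator_simps[OF assms(1)])

lemma operator_root_product:
  assumes "operator T" shows "operator (root_product T cs)"
proof (induction cs)
  case Nil
  show ?case using linear_id by (simp add: root_product_def id_def)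
next
  case (Cons c cs)
  show ?case
    by (rule operatorI)
      (simp_all add: operator_simps[OF assms] operator_simps[OF Cons] scale_right_distrib mult.commute
        scale_right_diff_distrib)
qed

lemma root_product_Cons':
  assumes "operator T"
  shows "root_product T (c # cs) x = root_product T cs (T x - c *s x)"
proof -
  have "root_product T cs (T x) = T (root_product T cs x)"
    by (rule root_product_intertwine[OF assms]) simp
  then show ?thesis by (simp add: operator_simps[OF operator_root_product[OF assms]])
qed

lemma root_product_eigenvector:
  assumes "T x = b *s x" and T: "operator T"
  shows "root_product T cs x = (\<Prod>c\<leftarrow>cs. b - c) *s x"
proof (induction cs)
  case (Cons c cs)
  have "root_product T (c # cs) x = (b - c) *s root_product T cs x"
    by (simp add: Cons operator_simps[OF T] assms(1) scale_left_diff_distrib left_diff_distrib mult.commute)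
  then show ?case by (simp only: Cons) simp
qed simp

text \<open>
The coprimality argument for two polynomials in \<open>T\<close>, one linear factor at a time: after induction
\<open>T x = c x\<close> for a root \<open>c\<close> of the first product, and the second product is then a nonzero scalar
on \<open>x\<close>.
\<close>

lemma root_product_disjoint:
  assumes T: "operator T" and "root_product T cs x = 0" "root_product T ds x = 0"
    and "set cs \<inter> set ds = {}"
  shows "x = 0"
  using assms(2-4)
proof (induction cs arbitrary: x)
  case (Cons c cs)
  let ?y = "T x - c *s x"
  have "root_product T ds (T x) = T (root_product T ds x)"
    by (rule root_product_intertwine[OF T]) simp
  then have "root_product T ds ?y = 0"
    using Cons.prems(2) by (simp add: operator_simps[OF T] operator_simps[OF operator_root_product[OF T]])
  then have "?y = 0"
    using Cons.IH[of ?y] Cons.prems(1,3) root_product_Cons'[OF T, of c cs x] by simp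
  then have "(\<Prod>d\<leftarrow>ds. c - d) *s x = 0"
    using Cons.prems(2) root_product_eigenvector[OF _ T, of x c ds] by simp
  moreover have "(\<Prod>d\<leftarrow>ds. c - d) \<noteq> 0" using Cons.prems(3) by (auto simp: prod_list_zero_iff)
  ultimately show ?case by simp
qed simp

end

locale finite_dim_operator_space = operator_space scale
  for scale :: "'a::alg_closed_field \<Rightarrow> 'b::ab_group_add \<Rightarrow> 'b" (infixr \<open>*s\<close> 75) +
  assumes finite_dimensional: "\<exists>B. finite B \<and> span B = UNIV"
begin

lemma root_product_of_polynomial_relation:
  assumes T: "operator T" and "p \<noteq> 0" "degree p \<le> n"
    and "(\<Sum>i\<le>n. coeff p i *s (T ^^ i) x) = 0"
  shows "\<exists>cs. root_product T cs x = 0"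
  using assms(2-4)
proof (induction n arbitrary: p x)
  case 0
  then show ?case by (intro exI[of _ "[]"]) (use leading_coeff_0_iff[of p] in auto)
next
  case (Suc n)
  show ?case
  proof (cases "degree p = 0")
    case True
    then have "(\<Sum>i\<le>n. coeff p i *s (T ^^ i) x) = 0"
      using Suc.prems(3) by (simp add: coeff_eq_0)
    then show ?thesis using Suc True by auto
  next
    case False
    then obtain c where "poly p c = 0" using alg_closed_imp_poly_has_root by blast
    then obtain r where r: "p = [:- c, 1:] * r" by (auto simp: poly_eq_0_iff_dvd)
    have r0: "r \<noteq> 0" using r Suc.prems(1) by auto
    have deg: "degree r \<le> n" using Suc.prems(2) unfolding r by (subst (asm) degree_mult_eq) (use r0 in auto)
    let ?y = "T x - c *s x"
    have shift: "(T ^^ i) ?y = (T ^^ Suc i) x - c *s (T ^^ i) x" for i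
      by (induction i) (simp_all add: operator_simps[OF T])
    have p: "p = pCons 0 r - smult c r" by (simp add: r)
    have "(\<Sum>i\<le>n. coeff r i *s (T ^^ i) ?y)
      = (\<Sum>i\<le>n. coeff r i *s (T ^^ Suc i) x) - (\<Sum>i\<le>n. (c * coeff r i) *s (T ^^ i) x)"
      unfolding shift by (simp add: scale_right_diff_distrib sum_subtractf mult.commute)
    also have "(\<Sum>i\<le>n. coeff r i *s (T ^^ Suc i) x) = (\<Sum>i\<le>Suc n. coeff (pCons 0 r) i *s (T ^^ i) x)"
      by (simp only: sum.atMost_Suc_shift) simp
    also have "(\<Sum>i\<le>n. (c * coeff r i) *s (T ^^ i) x) = (\<Sum>i\<le>Suc n. coeff (smult c r) i *s (T ^^ i) x)"
      using deg by (simp add: coeff_eq_0)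
    also have "(\<Sum>i\<le>Suc n. coeff (pCons 0 r) i *s (T ^^ i) x) - \<dots> = (\<Sum>i\<le>Suc n. coeff p i *s (T ^^ i) x)"
      unfolding p by (simp only: sum_subtractf[symmetric] coeff_diff scale_left_diff_distrib)
    also have "\<dots> = 0" by (rule Suc.prems(3))
    finally obtain cs where "root_product T cs ?y = 0" using Suc.IH[OF r0 deg] by blast
    then have "root_product T (c # cs) x = 0" by (simp add: root_product_Cons'[OF T] del: root_product_simps)
    then show ?thesis by blast
  qed
qed

text \<open>
The powers \<open>T\<^sup>i x\<close> with \<open>i\<close> at most the size of a finite generating set either repeat or are
linearly dependent. In both cases some nonzero polynomial in \<open>T\<close> annihilates \<open>x\<close>, and over an
algebraically closed field it is a product of linear factors.
\<close>

lemma pointwise_root_product: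
  assumes T: "operator T"
  shows "\<exists>cs. root_product T cs x = 0"
proof -
  obtain B where B: "finite B" "span B = UNIV" using finite_dimensional by blast
  let ?n = "card B" let ?g = "\<lambda>i. (T ^^ i) x"
  have "\<exists>p. p \<noteq> 0 \<and> degree p \<le> ?n \<and> (\<Sum>i\<le>?n. coeff p i *s ?g i) = 0"
  proof (cases "inj_on ?g {..?n}")
    case True
    have "dependent (?g ` {..?n})"
      using independent_span_bound[OF B(1), of "?g ` {..?n}"] B(2) card_image[OF True] by auto
    then obtain u where u: "(\<Sum>y\<in>?g ` {..?n}. u y *s y) = 0" "\<exists>i\<le>?n. u (?g i) \<noteq> 0"
      by (subst (asm) dependent_finite) auto
    let ?p = "\<Sum>i\<le>?n. monom (u (?g i)) i"
    have coeff: "coeff ?p i = (if i \<le> ?n then u (?g i) else 0)" for i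
      by (simp add: coeff_sum)
    have "?p \<noteq> 0" using u(2) coeff by (metis coeff_0)
    moreover have "degree ?p \<le> ?n" by (rule degree_le) (simp add: coeff)
    moreover have "(\<Sum>i\<le>?n. coeff ?p i *s ?g i) = 0"
      using u(1) by (simp add: coeff sum.reindex[OF True])
    ultimately show ?thesis by blast
  next
    case False
    then obtain i j where ij: "i < j" "j \<le> ?n" "?g i = ?g j"
      unfolding inj_on_def by (metis atMost_iff linorder_neqE_nat)
    let ?p = "monom 1 i - monom 1 j :: 'a poly"
    have "coeff ?p i \<noteq> 0" using ij by simp
    then have "?p \<noteq> 0" by (metis coeff_0)
    moreover have "degree ?p \<le> ?n" by (rule degree_le) (use ij in auto)
    moreover have "(\<Sum>k\<le>?n. coeff ?p k *s ?g k) = 0"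
    proof -
      have "(\<Sum>k\<le>?n. coeff ?p k *s ?g k)
          = (\<Sum>k\<le>?n. if k = i then ?g k else 0) - (\<Sum>k\<le>?n. if k = j then ?g k else 0)"
        unfolding sum_subtractf[symmetric] by (rule sum.cong) auto
      then show ?thesis using ij by simp
    qed
    ultimately show ?thesis by blast
  qed
  then show ?thesis using root_product_of_polynomial_relation[OF T] by blast
qed

lemma annihilating_root_product:
  assumes T: "operator T"
  obtains cs where "\<And>x. root_product T cs x = 0"
proof -
  obtain B where B: "finite B" "span B = UNIV" using finite_dimensional by blast
  have "\<exists>cs. \<forall>x\<in>B. root_product T cs x = 0"
    using B(1)
  proof (induction B rule: finite_induct)
    case (insert x B)
    then obtain cs where cs: "\<forall>x\<in>B. root_product T cs x = 0" by blast
    obtain ds where ds: "root_product T ds x = 0" using pointwise_root_product[OF T] by blast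
    have "root_product T cs (root_product T ds y) = root_product T ds (root_product T cs y)" for y
    proof (rule root_product_intertwine[OF operator_root_product[OF T]])
      show "T (root_product T ds z) = root_product T ds (T z)" for z
        by (rule root_product_intertwine[OF T, symmetric]) simp
    qed
    then have "root_product T (cs @ ds) y = root_product T ds (root_product T cs y)" for y
      by (simp only: root_product_simps(3))
    note swap = this
    have "root_product T (cs @ ds) y = 0" if "y \<in> insert x B" for y
      using that cs ds operator_simps(4)[OF operator_root_product[OF T]]
      by (cases "y = x") (simp, simp add: swap del: root_product_simps)
    then have "\<forall>y\<in>insert x B. root_product T (cs @ ds) y = 0" by blast
    then show ?case by blast
  qed simp
  then obtain cs where cs: "\<forall>x\<in>B. root_product T cs x = 0" by blast
  have "subspace {x. root_product T cs x = 0}"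
    by (rule subspaceI) (simp_all add: operator_simps[OF operator_root_product[OF T]])
  then have "root_product T cs x = 0" for x
    using span_subspace_induct[of x B "{x. root_product T cs x = 0}"] cs B(2) by auto
  then show thesis by (rule that)
qed

text \<open>
An annihilating product of linear factors reaches every vector from \<open>0\<close> in finitely many steps,
and semisimplicity keeps each step inside the span of the eigenvectors.
\<close>

lemma eigenspan_UNIV_if_semisimple:
  assumes T: "operator T"
    and ss: "\<And>c z. T (T z - c *s z) = c *s (T z - c *s z) \<Longrightarrow> T z = c *s z"
  shows "eigenspan T UNIV = UNIV"
proof -
  obtain cs where cs: "\<And>x. root_product T cs x = 0" using annihilating_root_product[OF T] by blast
  have "root_product T cs x = 0 \<Longrightarrow> x \<in> eigenspan T UNIV" for x
  proof (induction cs arbitrary: x)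
    case Nil
    then show ?case using subspace_0[OF subspace_eigenspan] by simp
  next
    case (Cons c cs)
    then have "T x - c *s x \<in> eigenspan T UNIV"
      using root_product_Cons'[OF T] by metis
    with ss show ?case by (rule eigenspan_semisimple_step[OF T])
  qed
  then show ?thesis using cs by blast
qed

lemma finite_eigenvalues:
  assumes T: "operator T"
  shows "finite {c. \<exists>x. x \<noteq> 0 \<and> T x = c *s x}"
proof -
  obtain cs where cs: "\<And>x. root_product T cs x = 0" using annihilating_root_product[OF T] by blast
  have "c \<in> set cs" if "x \<noteq> 0" "T x = c *s x" for c x
  proof -
    have "(\<Prod>b\<leftarrow>cs. c - b) *s x = 0"
      using cs[of x] by (simp only: root_product_eigenvector[OF that(2) T])
    then show ?thesis using that(1) by (auto simp: prod_list_zero_iff)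
  qed
  then have "{c. \<exists>x. x \<noteq> 0 \<and> T x = c *s x} \<subseteq> set cs" by blast
  then show ?thesis by (rule finite_subset) simp
qed

text \<open>
Since \<open>S\<^sup>n\<close> intertwines \<open>T\<close> with \<open>u\<^sup>n T\<close>, the image of \<open>S\<^sup>n\<close> is annihilated both by the product over
the roots \<open>cs\<close> and by the product over the rescaled roots \<open>u\<^sup>n cs\<close>. The roots may be taken nonzero,
and as \<open>u\<close> is not a root of unity the two sets are disjoint for some \<open>n\<close>, which forces \<open>S\<^sup>n = 0\<close>.
\<close>

lemma nilpotent_if_rescales_invertible:
  assumes T: "operator T" and inj: "\<And>x. T x = 0 \<Longrightarrow> x = 0"
    and S: "operator S" and rel: "\<And>x. T (S x) = u *s S (T x)"
    and u: "u \<noteq> 0" "\<And>n. u ^ n = 1 \<Longrightarrow> n = 0"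
  obtains N where "\<And>x. (S ^^ N) x = 0"
proof -
  obtain cs' where cs': "\<And>x. root_product T cs' x = 0" using annihilating_root_product[OF T] by blast
  \<comment> \<open>Factors \<open>T - 0\<close> may be cancelled as \<open>T\<close> is injective.\<close>
  define cs where "cs = filter (\<lambda>c. c \<noteq> 0) cs'"
  have "root_product T (filter (\<lambda>c. c \<noteq> 0) ds) x = 0" if "root_product T ds x = 0" for ds x
    using that
  proof (induction ds arbitrary: x)
    case (Cons d ds)
    show ?case
    proof (cases "d = 0")
      case True
      have "root_product T ds x = 0" by (rule inj) (use Cons.prems True in simp)
      then show ?thesis using Cons.IH True by simp
    next
      case False
      then show ?thesis
        using Cons.IH[of "T x - d *s x"] Cons.prems root_product_Cons'[OF T]
        by (simp del: root_product_simps)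
    qed
  qed simp
  then have cs: "root_product T cs x = 0" for x using cs' by (simp add: cs_def)
  have cs0: "c \<noteq> 0" if "c \<in> set cs" for c using that by (simp add: cs_def)
  \<comment> \<open>the exponents for which the rescaled roots meet the roots\<close>
  let ?bad = "\<Union>a\<in>set cs. \<Union>b\<in>set cs. {n. u ^ n * a = b}"
  have "finite {n. u ^ n * a = b}" if "a \<noteq> 0" for a b
  proof -
    have "m = n" if "u ^ m * a = b" "u ^ n * a = b" for m n
    proof -
      have *: "u ^ m = u ^ n" using that \<open>a \<noteq> 0\<close> by (metis mult_right_cancel)
      have "u ^ (i - j) = 1" if "u ^ i = u ^ j" for i j
      proof (cases "j \<le> i")
        case True
        then have "u ^ (i - j) * u ^ j = u ^ j" using that by (simp add: power_add[symmetric])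
        then show ?thesis using u(1) by simp
      qed simp
      from this[OF *] this[OF *[symmetric]] have "u ^ (m - n) = 1" "u ^ (n - m) = 1" .
      then show ?thesis using u(2)[of "m - n"] u(2)[of "n - m"] by simp
    qed
    then have "\<exists>k. {n. u ^ n * a = b} \<subseteq> {k}" by blast
    then show ?thesis using finite_subset by blast
  qed
  then have "finite ?bad" using cs0 by (intro finite_UN_I) auto
  then obtain N where N: "N \<notin> ?bad" using ex_new_if_finite[OF infinite_UNIV_nat] by blast
  have rel': "T ((S ^^ n) x) = u ^ n *s (S ^^ n) (T x)" for n x
    by (induction n) (simp_all add: rel operator_simps[OF S] mult.commute)
  have opS: "operator (S ^^ n)" for n
    by (rule operatorI; induction n) (simp_all add: operator_simps[OF S])
  have "root_product T (map ((*) (u ^ N)) ds) ((S ^^ N) x)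
      = u ^ (N * length ds) *s (S ^^ N) (root_product T ds x)" for ds x
    by (induction ds)
      (simp_all add: operator_simps[OF T] operator_simps[OF opS] rel' scale_right_diff_distrib power_add mult_ac)
  then have "root_product T (map ((*) (u ^ N)) cs) ((S ^^ N) x) = 0" for x
    using cs operator_simps(4)[OF opS] by simp
  moreover have "set (map ((*) (u ^ N)) cs) \<inter> set cs = {}" using N by auto
  ultimately have "(S ^^ N) x = 0" for x
    using root_product_disjoint[OF T] cs by blast
  then show thesis by (rule that)
qed

end


section \<open>Finite-dimensional modules over quantum sl2\<close>

text \<open>
\<open>K'\<close> is the inverse of \<open>K\<close>, and \<open>type_one\<close> excludes the signs that eigenvalues of \<open>K\<close> could carry
otherwise.
\<close>

locale quantum_sl2_module = finite_dim_operator_space scale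
  for scale :: "'a::alg_closed_field \<Rightarrow> 'b::ab_group_add \<Rightarrow> 'b" (infixr \<open>*s\<close> 75) +
  fixes v :: 'a and E F K K' :: "'b \<Rightarrow> 'b"
  assumes v_nonzero: "v \<noteq> 0" and v_generic: "v ^ n = 1 \<Longrightarrow> n = 0" and two_nonzero: "(2::'a) \<noteq> 0"
    and operators: "operator E" "operator F" "operator K" "operator K'"
    and K_inverse: "K (K' x) = x" "K' (K x) = x"
    and K_E: "K (E x) = v powi 2 *s E (K x)" and K_F: "K (F x) = v powi (- 2) *s F (K x)"
    and commutator: "E (F x) - F (E x) = (1 / (v - inverse v)) *s (K x - K' x)"
    and type_one: "x \<noteq> 0 \<Longrightarrow> K x = c *s x \<Longrightarrow> \<exists>n. c = v powi n"
begin

lemmas op_simps = operators[THEN operator_simps(1)] operators[THEN operator_simps(2)]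
  operators[THEN operator_simps(3)] operators[THEN operator_simps(4)] operators[THEN operator_simps(5)]

lemma powi_eq_1_iff: "v powi n = 1 \<longleftrightarrow> n = 0"
proof
  assume *: "v powi n = 1"
  show "n = 0"
  proof (cases "n \<ge> 0")
    case True
    then have "v ^ nat n = 1" using * by (simp add: power_int_def)
    then show ?thesis using v_generic[of "nat n"] True by simp
  next
    case False
    then have "v ^ nat (- n) = 1" using * by (simp add: power_int_def power_inverse inverse_eq_1_iff)
    then show ?thesis using v_generic[of "nat (- n)"] False by simp
  qed
qed simp

lemma powi_add: "v powi (m + n) = v powi m * v powi n"
  by (rule power_int_add) (simp add: v_nonzero)

lemma powi_nonzero [simp]: "v powi n \<noteq> 0"
  using v_nonzero by simp

lemma powi_inject: "v powi m = v powi n \<longleftrightarrow> m = n"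
proof
  assume "v powi m = v powi n"
  then have "v powi (m - n) = 1" using v_nonzero by (simp add: power_int_diff)
  then show "m = n" by (simp add: powi_eq_1_iff)
qed simp

lemma v_diff_nonzero: "v - inverse v \<noteq> 0"
proof
  assume "v - inverse v = 0"
  then have "v powi 1 = v powi (- 1)" by (simp add: power_int_minus)
  then show False by (simp only: powi_inject)
qed

lemma K'_E: "K' (E x) = v powi (- 2) *s E (K' x)"
proof -
  have "K' (K (E (K' x))) = v powi 2 *s K' (E x)"
    by (simp only: K_E K_inverse op_simps)
  then show ?thesis by (simp add: K_inverse power_int_minus v_nonzero)
qed

lemma K'_F: "K' (F x) = v powi 2 *s F (K' x)"
proof -
  have "K' (K (F (K' x))) = v powi (- 2) *s K' (F x)"
    by (simp only: K_F K_inverse op_simps)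
  then show ?thesis by (simp add: K_inverse power_int_minus v_nonzero)
qed

lemma scale_powi_cancel: "v powi (- n) *s (v powi n *s x) = x" "v powi n *s (v powi (- n) *s x) = x"
  by (simp_all only: scale_scale powi_add[symmetric]) simp_all

lemma K_weight_iff: "K x = v powi n *s x \<longleftrightarrow> K' x = v powi (- n) *s x"
proof
  assume "K x = v powi n *s x"
  then have "K' (K x) = v powi n *s K' x" by (simp only: op_simps)
  then show "K' x = v powi (- n) *s x" by (metis K_inverse(2) scale_powi_cancel(1))
next
  assume "K' x = v powi (- n) *s x"
  then have "K (K' x) = v powi (- n) *s K x" by (simp only: op_simps)
  then show "K x = v powi n *s x" by (metis K_inverse(1) scale_powi_cancel(2))
qed

text \<open>
The symmetry that exchanges \<open>E\<close> with \<open>F\<close> and \<open>K\<close> with \<open>K'\<close> turns weights into their negatives.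
\<close>

lemma swapped_module: "quantum_sl2_module scale v F E K' K"
proof (intro quantum_sl2_module.intro quantum_sl2_module_axioms.intro finite_dim_operator_space_axioms)
  show "v ^ n = 1 \<Longrightarrow> n = 0" for n by (rule v_generic)
  show "F (E x) - E (F x) = (1 / (v - inverse v)) *s (K' x - K x)" for x
    using arg_cong[OF commutator[of x], of uminus]
    by (simp add: scale_right_diff_distrib)
  show "\<exists>n. c = v powi n" if "x \<noteq> 0" "K' x = c *s x" for x c
  proof -
    have c: "x = c *s K x" using that(2) K_inverse(1)[of x] by (simp add: op_simps)
    then have "c \<noteq> 0" using that(1) by auto
    have "(1 / c) *s x = (1 / c) *s (c *s K x)" using c by (rule arg_cong)
    then have "K x = (1 / c) *s x" using \<open>c \<noteq> 0\<close> by simp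
    then obtain n where "1 / c = v powi n" using type_one[OF \<open>x \<noteq> 0\<close>] by blast
    then have "c = v powi (- n)" by (metis inverse_eq_divide inverse_inverse_eq power_int_minus)
    then show ?thesis by blast
  qed
qed (rule v_nonzero two_nonzero operators K_inverse K'_E K'_F)+

text \<open>
The quantum Casimir element commutes with all generators. With \<open>j = 1\<close> and \<open>j = -1\<close> its shifts by
\<open>(v\<^sup>j K + v\<^sup>-\<^sup>j K') / (v - v\<^sup>-\<^sup>1)\<^sup>2\<close> are the products \<open>FE\<close> and \<open>EF\<close>. Moving a shift past \<open>E\<close> or \<open>F\<close>
changes \<open>j\<close> by \<open>2\<close>, so \<open>F\<^sup>r E\<^sup>r\<close> and \<open>E\<^sup>r F\<^sup>r\<close> become products of shifts over the odd numbers from \<open>1\<close>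
to \<open>2r - 1\<close> and from \<open>-1\<close> to \<open>-(2r - 1)\<close>.
\<close>

definition casimir :: "'b \<Rightarrow> 'b" where
  "casimir x = F (E x) + (1 / (v - inverse v)\<^sup>2) *s (v powi 1 *s K x + v powi (- 1) *s K' x)"

definition shifted_casimir :: "int \<Rightarrow> 'b \<Rightarrow> 'b" where
  "shifted_casimir j x =
     casimir x - (1 / (v - inverse v)\<^sup>2) *s (v powi j *s K x + v powi (- j) *s K' x)"

lemma F_E: "F (E x) = shifted_casimir 1 x"
  by (simp add: shifted_casimir_def casimir_def)

lemma E_F: "E (F x) = shifted_casimir (- 1) x"
proof -
  let ?\<delta> = "1 / (v - inverse v)\<^sup>2"
  have \<delta>: "1 / (v - inverse v) = ?\<delta> * (v - inverse v)"
    using v_diff_nonzero by (simp add: power2_eq_square)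
  have "E (F x) = F (E x) + (?\<delta> * (v - inverse v)) *s (K x - K' x)"
    using commutator[of x] unfolding \<delta> by (metis diff_add_cancel add.commute)
  also have "\<dots> = shifted_casimir (- 1) x"
    unfolding shifted_casimir_def casimir_def
    by (simp add: algebra_simps diff_divide_distrib power_int_minus)
  finally show ?thesis .
qed

lemma operator_casimir: "operator casimir"
  unfolding casimir_def
  by (rule operatorI) (simp_all add: op_simps scale_right_distrib mult_ac)

lemma casimir_eq: "casimir x = E (F x) + (1 / (v - inverse v)\<^sup>2) *s (v powi (- 1) *s K x + v powi 1 *s K' x)"
  unfolding E_F shifted_casimir_def by simp

lemma operator_shifted_casimir: "operator (shifted_casimir j)"
  unfolding shifted_casimir_def
  by (rule operatorI) (simp_all add: op_simps operator_simps[OF operator_casimir] scale_right_distrib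
      scale_right_diff_distrib mult_ac)

lemma powi_mult_inverse: "v powi 2 * v powi (- 2) = 1" "v powi (- 2) * v powi 2 = 1"
  by (simp_all only: powi_add[symmetric]) simp_all

lemma casimir_commutes:
  "casimir (K x) = K (casimir x)" "casimir (K' x) = K' (casimir x)"
  "casimir (F x) = F (casimir x)" "casimir (E x) = E (casimir x)"
proof -
  show "casimir (K x) = K (casimir x)" "casimir (K' x) = K' (casimir x)"
    unfolding casimir_def by (simp_all add: op_simps K_E K_F K'_E K'_F K_inverse powi_mult_inverse del: power_int_numeral)
  have "casimir (F x) = F (E (F x)) + (1 / (v - inverse v)\<^sup>2) *s
      ((v powi 1 * v powi (- 2)) *s F (K x) + (v powi (- 1) * v powi 2) *s F (K' x))"
    unfolding casimir_def by (simp add: K_F K'_F)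
  also have "\<dots> = F (casimir x)"
    unfolding casimir_eq[of x] by (simp only: powi_add[symmetric] op_simps) simp
  finally show "casimir (F x) = F (casimir x)" .
  have "casimir (E x) = E (F (E x)) + (1 / (v - inverse v)\<^sup>2) *s
      ((v powi (- 1) * v powi 2) *s E (K x) + (v powi 1 * v powi (- 2)) *s E (K' x))"
    unfolding casimir_eq by (simp add: K_E K'_E)
  also have "\<dots> = E (casimir x)"
    unfolding casimir_def[of x] by (simp only: powi_add[symmetric] op_simps) simp
  finally show "casimir (E x) = E (casimir x)" .
qed

lemma shifted_casimir_K:
  "shifted_casimir j (K x) = K (shifted_casimir j x)"
  unfolding shifted_casimir_def by (simp add: op_simps casimir_commutes K_inverse)

lemma shifted_casimir_commute:
  "shifted_casimir i (shifted_casimir j x) = shifted_casimir j (shifted_casimir i x)"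
proof -
  have "casimir (shifted_casimir i x) = shifted_casimir i (casimir x)"
    "K (shifted_casimir i x) = shifted_casimir i (K x)"
    "K' (shifted_casimir i x) = shifted_casimir i (K' x)"
    unfolding shifted_casimir_def
    by (simp_all add: op_simps operator_simps[OF operator_casimir] casimir_commutes K_inverse)
  then show ?thesis
    unfolding shifted_casimir_def[of j] by (simp add: operator_simps[OF operator_shifted_casimir])
qed

lemma shifted_casimir_F: "shifted_casimir j (F x) = F (shifted_casimir (j - 2) x)"
proof -
  have "shifted_casimir j (F x) = F (casimir x) - (1 / (v - inverse v)\<^sup>2) *s
      ((v powi j * v powi (- 2)) *s F (K x) + (v powi (- j) * v powi 2) *s F (K' x))"
    unfolding shifted_casimir_def by (simp add: K_F K'_F casimir_commutes)
  also have "\<dots> = F (shifted_casimir (j - 2) x)"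
    unfolding shifted_casimir_def by (simp only: powi_add[symmetric] op_simps) simp
  finally show ?thesis .
qed

lemma shifted_casimir_E: "shifted_casimir j (E x) = E (shifted_casimir (j + 2) x)"
proof -
  have "shifted_casimir j (E x) = E (casimir x) - (1 / (v - inverse v)\<^sup>2) *s
      ((v powi j * v powi 2) *s E (K x) + (v powi (- j) * v powi (- 2)) *s E (K' x))"
    unfolding shifted_casimir_def by (simp add: K_E K'_E casimir_commutes)
  also have "\<dots> = E (shifted_casimir (j + 2) x)"
    unfolding shifted_casimir_def by (simp only: powi_add[symmetric] op_simps) simp
  finally show ?thesis .
qed

lemma shifted_casimir_F_power:
  "shifted_casimir j ((F ^^ r) x) = (F ^^ r) (shifted_casimir (j - 2 * int r) x)"
  by (induction r arbitrary: j) (simp_all add: shifted_casimir_F algebra_simps)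

lemma shifted_casimir_E_power:
  "shifted_casimir j ((E ^^ r) x) = (E ^^ r) (shifted_casimir (j + 2 * int r) x)"
  by (induction r arbitrary: j) (simp_all add: shifted_casimir_E algebra_simps)

lemma F_power_E_power:
  "(F ^^ r) ((E ^^ r) x) = foldr shifted_casimir (map (\<lambda>i. 2 * int i + 1) [0..<r]) x"
proof (induction r arbitrary: x)
  case (Suc r)
  have "(F ^^ Suc r) ((E ^^ Suc r) x) = (F ^^ r) (F (E ((E ^^ r) x)))"
    by (simp add: funpow_swap1)
  also have "\<dots> = (F ^^ r) ((E ^^ r) (shifted_casimir (1 + 2 * int r) x))"
    by (simp only: F_E shifted_casimir_E_power)
  finally show ?case by (simp add: Suc add.commute)
qed simp

lemma E_power_F_power:
  "(E ^^ r) ((F ^^ r) x) = foldr shifted_casimir (map (\<lambda>i. - (2 * int i + 1)) [0..<r]) x"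
proof (induction r arbitrary: x)
  case (Suc r)
  have "(E ^^ Suc r) ((F ^^ Suc r) x) = (E ^^ r) (E (F ((F ^^ r) x)))"
    by (simp add: funpow_swap1)
  also have "\<dots> = (E ^^ r) ((F ^^ r) (shifted_casimir (- 1 - 2 * int r) x))"
    by (simp only: E_F shifted_casimir_F_power)
  finally show ?case by (simp add: Suc algebra_simps)
qed simp

lemma nilpotent:
  obtains N where "\<And>x. (E ^^ N) x = 0" "\<And>x. (F ^^ N) x = 0"
proof -
  have inj: "x = 0" if "K x = 0" for x using K_inverse(2)[of x] that by (simp add: op_simps)
  have generic: "n = 0" if "(v powi m) ^ n = 1" "m \<noteq> 0" for m n
  proof -
    have "v powi (m * int n) = 1" using that by (simp add: power_int_mult)
    then show ?thesis using that(2) by (simp add: powi_eq_1_iff)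
  qed
  obtain M where M: "\<And>x. (E ^^ M) x = 0"
    by (rule nilpotent_if_rescales_invertible[OF operators(3) inj operators(1) K_E])
      (use generic[of 2] v_nonzero in auto)
  obtain N where N: "\<And>x. (F ^^ N) x = 0"
    by (rule nilpotent_if_rescales_invertible[OF operators(3) inj operators(2) K_F])
      (use generic[of "- 2"] v_nonzero in auto)
  have E0: "(E ^^ k) 0 = 0" and F0: "(F ^^ k) 0 = 0" for k by (induction k) (simp_all add: op_simps)
  show thesis
  proof
    show "(E ^^ (M + N)) x = 0" for x by (subst add.commute) (simp add: funpow_add M E0)
    show "(F ^^ (M + N)) x = 0" for x by (simp add: funpow_add N F0)
  qed
qed

end


section \<open>Diagonalizability of the Cartan generator\<close>

text \<open>
The operators \<open>G i\<close> commute with each other and with \<open>D\<close>, and a product of them annihilates \<open>x\<close>. If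
the product has two factors \<open>G i\<close> and \<open>G j\<close>, then dropping either factor and induction give
\<open>D (G i x) = D (G j x) = 0\<close>, that is, \<open>D x\<close> lies in the kernels of \<open>G i\<close> and \<open>G j\<close>. So a claim
\<open>D x = 0\<close> reduces to vectors annihilated by a single factor, provided that \<open>D x\<close> cannot be a
nonzero vector in two of the kernels.
\<close>

lemma reduce_commuting_product:
  fixes G :: "'i \<Rightarrow> 'b::ab_group_add \<Rightarrow> 'b" and D :: "'b \<Rightarrow> 'b"
  assumes comm: "\<And>i j x. G i (G j x) = G j (G i x)" and D: "\<And>i x. D (G i x) = G i (D x)" "D 0 = 0"
    and Y: "\<And>i x. x \<in> Y \<Longrightarrow> G i x \<in> Y"
    and single: "\<And>i x. i \<in> J \<Longrightarrow> x \<in> Y \<Longrightarrow> G i x = 0 \<Longrightarrow> D x = 0"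
    and pair: "\<And>i j x. i \<in> J \<Longrightarrow> j \<in> J \<Longrightarrow> i \<noteq> j \<Longrightarrow> x \<in> Y \<Longrightarrow>
      G i (D x) = 0 \<Longrightarrow> G j (D x) = 0 \<Longrightarrow> D x = 0"
    and "set js \<subseteq> J" "distinct js" "x \<in> Y" "foldr G js x = 0"
  shows "D x = 0"
  using assms(7-)
proof (induction "length js" arbitrary: js x)
  case 0
  then show ?case using D(2) by simp
next
  case (Suc n)
  have swap: "foldr G ks (G i y) = G i (foldr G ks y)" for ks i y
    by (induction ks) (simp_all add: comm)
  obtain i js' where js: "js = i # js'" using Suc.hyps(2) by (cases js) auto
  show ?case
  proof (cases js')
    case Nil
    then show ?thesis using single[of i x] Suc.prems js by simp
  next
    case (Cons j ks)
    have "foldr G (j # ks) (G i x) = foldr G js x" "foldr G (i # ks) (G j x) = foldr G js x"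
      using comm[of i j] by (simp_all add: js Cons swap)
    then have "D (G i x) = 0" "D (G j x) = 0"
      using Suc.hyps(1)[of "j # ks" "G i x"] Suc.hyps(1)[of "i # ks" "G j x"] Suc.prems Suc.hyps(2)
        js Cons Y by auto
    then show ?thesis using pair[of i j x] Suc.prems js Cons by (simp add: D(1))
  qed
qed

context quantum_sl2_module
begin

lemma shifted_casimir_diff:
  "shifted_casimir i x - shifted_casimir j x
    = (1 / (v - inverse v)\<^sup>2 * (v powi j - v powi i)) *s (K x - v powi (- i - j) *s K' x)"
proof -
  define \<delta> where "\<delta> = 1 / (v - inverse v)\<^sup>2"
  define a b a' b' where parts: "a = v powi i" "b = v powi j" "a' = v powi (- i)" "b' = v powi (- j)"
  have diff: "b' - a' = - ((b - a) * v powi (- i - j))"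
  proof -
    have "b * v powi (- i - j) = a'" "a * v powi (- i - j) = b'"
      unfolding parts powi_add[symmetric] by simp_all
    then show ?thesis by (simp only: left_diff_distrib minus_diff_eq)
  qed
  have "shifted_casimir i x - shifted_casimir j x = \<delta> *s ((b - a) *s K x + (b' - a') *s K' x)"
    unfolding shifted_casimir_def \<delta>_def[symmetric] parts[symmetric]
    by (simp add: scale_right_distrib scale_left_diff_distrib scale_right_diff_distrib)
  also have "\<dots> = (\<delta> * (b - a)) *s (K x - v powi (- i - j) *s K' x)"
    unfolding diff by (simp add: scale_right_diff_distrib)
  finally show ?thesis unfolding parts \<delta>_def .
qed

text \<open>
Two shifts differ by a nonzero multiple of \<open>K - v\<^sup>-\<^sup>i\<^sup>-\<^sup>j K'\<close>.
\<close>

lemma shifted_casimir_common_kernel: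
  assumes "shifted_casimir i x = 0" "shifted_casimir j x = 0" "i \<noteq> j"
  shows "K (K x) = v powi (- i - j) *s x"
proof -
  have "(1 / (v - inverse v)\<^sup>2 * (v powi j - v powi i)) *s (K x - v powi (- i - j) *s K' x) = 0"
    using shifted_casimir_diff[of i x j] assms(1,2) by simp
  moreover have "1 / (v - inverse v)\<^sup>2 * (v powi j - v powi i) \<noteq> 0"
    using v_diff_nonzero assms(3) by (simp add: powi_inject)
  ultimately have "K x = v powi (- i - j) *s K' x" by (metis scale_eq_0_iff right_minus_eq)
  then have "K (K x) = K (v powi (- i - j) *s K' x)" by (rule arg_cong)
  then show ?thesis by (simp only: op_simps K_inverse)
qed

lemma shifted_casimir_common_kernel_weight:
  assumes "shifted_casimir i x = 0" "shifted_casimir j x = 0" "i \<noteq> j"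
    and "K x = v powi n *s x" "x \<noteq> 0"
  shows "i + j = - 2 * n"
proof -
  have "v powi (n + n) *s x = v powi (- i - j) *s x"
    using shifted_casimir_common_kernel[OF assms(1-3)]
    by (simp only: assms(4) op_simps powi_add scale_scale)
  then have "v powi (n + n) = v powi (- i - j)" using assms(5) by simp
  then show ?thesis by (simp only: powi_inject)
qed

text \<open>
Let \<open>D = K - v\<^sup>n\<close>; the vectors \<open>x\<close> with \<open>D (D x) = 0\<close> form \<open>Y\<close>. By nilpotency of \<open>E\<close> the product of
the shifted Casimir operators over positive odd numbers vanishes, and by nilpotency of \<open>F\<close> so
does the one over negative odd numbers.

If \<open>D x \<noteq> 0\<close> lies in the kernels of two shifts \<open>i \<noteq> j\<close>, then \<open>i + j = -2n\<close>. For positive \<open>i\<close>, \<open>j\<close>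
this contradicts \<open>n \<ge> 0\<close>, so it suffices to treat \<open>x\<close> annihilated by one shift \<open>j > 0\<close>. On such
vectors the equation determines the second shift from \<open>j\<close>, so one may assume that \<open>x\<close> is
annihilated by a single negative shift \<open>i\<close> as well. If now \<open>D x \<noteq> 0\<close>, then
\<open>K\<^sup>2 x = v\<^sup>-\<^sup>i\<^sup>-\<^sup>j x = v\<^sup>2\<^sup>n x\<close>, which together with \<open>D (D x) = 0\<close> gives \<open>2 v\<^sup>n D x = 0\<close>.
\<close>

lemma K_semisimple_nonneg:
  assumes "n \<ge> 0" and z: "K (K z - v powi n *s z) = v powi n *s (K z - v powi n *s z)"
  shows "K z = v powi n *s z"
proof -
  obtain N where N: "\<And>x. (E ^^ N) x = 0" "\<And>x. (F ^^ N) x = 0" using nilpotent by blast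
  define D where "D = (\<lambda>x. K x - v powi n *s x)"
  define Y where "Y = {x. K (D x) = v powi n *s D x}"
  have D0: "D 0 = 0" by (simp add: D_def op_simps)
  have DG: "D (shifted_casimir j x) = shifted_casimir j (D x)" for j x
    by (simp add: D_def shifted_casimir_K operator_simps[OF operator_shifted_casimir])
  have Y: "shifted_casimir j x \<in> Y" if "x \<in> Y" for j x
    using that
    by (simp add: Y_def DG shifted_casimir_K[symmetric] operator_simps[OF operator_shifted_casimir])
  have weight: "i + j = - 2 * n"
    if "x \<in> Y" "D x \<noteq> 0" "shifted_casimir i (D x) = 0" "shifted_casimir j (D x) = 0" "i \<noteq> j"
    for i j x
    using shifted_casimir_common_kernel_weight[OF that(3-5)] that(1,2) by (simp add: Y_def)
  have two_zeros: "D x = 0"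
    if x: "x \<in> Y" "shifted_casimir i x = 0" "shifted_casimir j x = 0" "i \<noteq> j" for i j x
  proof (rule ccontr)
    assume nz: "D x \<noteq> 0"
    have "shifted_casimir i (D x) = 0" "shifted_casimir j (D x) = 0"
      using x(2,3) DG D0 by metis+
    then have "i + j = - 2 * n" using weight[OF x(1) nz] x(4) by blast
    then have ij: "- i - j = n + n" by simp
    have "K (K x) = (v powi n * v powi n) *s x"
      using shifted_casimir_common_kernel[OF x(2-4)] unfolding ij powi_add .
    then have "K (D x) + v powi n *s D x = 0"
      by (simp add: D_def op_simps scale_right_diff_distrib)
    moreover have "K (D x) = v powi n *s D x" using x(1) by (simp add: Y_def)
    ultimately have "(2 * v powi n) *s D x = 0" by (simp only: mult_2 scale_left_distrib)
    then show False using nz two_nonzero v_nonzero by simp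
  qed
  have odd_zero: "D x = 0" if x: "x \<in> Y" "shifted_casimir j x = 0" and j: "j > 0" for j x
  proof (rule reduce_commuting_product[where G = shifted_casimir and D = D and Y = "{x\<in>Y. shifted_casimir j x = 0}"
        and js = "map (\<lambda>i. - (2 * int i + 1)) [0..<N]" and J = "{i. i < 0}"])
    show "shifted_casimir i y \<in> {x\<in>Y. shifted_casimir j x = 0}"
      if "y \<in> {x\<in>Y. shifted_casimir j x = 0}" for i y
      using that Y shifted_casimir_commute[of j i y] operator_simps(4)[OF operator_shifted_casimir]
      by simp
    show "D y = 0" if "i \<in> {i. i < (0::int)}"
      "y \<in> {x\<in>Y. shifted_casimir j x = 0}" "shifted_casimir i y = 0" for i y
      using that j two_zeros[of y i j] by auto
    show "D y = 0" if "i \<in> {i. i < (0::int)}"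
      "k \<in> {i. i < (0::int)}" "i \<noteq> k"
      "y \<in> {x\<in>Y. shifted_casimir j x = 0}" "shifted_casimir i (D y) = 0" "shifted_casimir k (D y) = 0"
      for i k y
    proof (rule ccontr)
      assume nz: "D y \<noteq> 0"
      have "shifted_casimir j (D y) = 0" using that(4) DG[of j y] D0 by simp
      then have "i + j = - 2 * n" "k + j = - 2 * n"
        using weight[of y i j] weight[of y k j] that nz j by simp_all
      then show False using that(3) by simp
    qed
    show "distinct (map (\<lambda>i. - (2 * int i + 1)) [0..<N])" by (simp add: distinct_map inj_on_def)
    show "foldr shifted_casimir (map (\<lambda>i. - (2 * int i + 1)) [0..<N]) x = 0"
      using E_power_F_power[of N x] N by simp
  qed (use x DG D0 shifted_casimir_commute in auto)
  have "D z = 0"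
  proof (rule reduce_commuting_product[where G = shifted_casimir and D = D and Y = Y
        and js = "map (\<lambda>i. 2 * int i + 1) [0..<N]" and J = "{i. i > 0}"])
    show "D y = 0" if "i \<in> {i. i > (0::int)}"
      "y \<in> Y" "shifted_casimir i y = 0" for i y
      using that odd_zero[of y i] by auto
    show "D y = 0" if "i \<in> {i. i > (0::int)}"
      "k \<in> {i. i > (0::int)}" "i \<noteq> k"
      "y \<in> Y" "shifted_casimir i (D y) = 0" "shifted_casimir k (D y) = 0" for i k y
      using weight[of y i k] that assms(1) by auto
    show "distinct (map (\<lambda>i. 2 * int i + 1) [0..<N])" by (simp add: distinct_map inj_on_def)
    show "foldr shifted_casimir (map (\<lambda>i. 2 * int i + 1) [0..<N]) z = 0"
      using F_power_E_power[of N z] N by simp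
    show "z \<in> Y" using z by (simp add: Y_def D_def)
  qed (use DG D0 Y shifted_casimir_commute in auto)
  then show ?thesis by (simp add: D_def)
qed

text \<open>
Negative weights are reduced to positive ones by exchanging \<open>E\<close> and \<open>F\<close>.
\<close>

lemma K_semisimple:
  assumes z: "K (K z - c *s z) = c *s (K z - c *s z)"
  shows "K z = c *s z"
proof (rule ccontr)
  assume "K z \<noteq> c *s z"
  then obtain n where c: "c = v powi n" using type_one[OF _ z] by auto
  show False
  proof (cases "n \<ge> 0")
    case True
    then show False using K_semisimple_nonneg[of n z] z \<open>K z \<noteq> c *s z\<close> c by simp
  next
    case False
    let ?c' = "v powi (- n)"
    let ?y = "K z - c *s z"
    interpret swapped: quantum_sl2_module scale v F E K' K by (rule swapped_module)
    have y: "K' z - ?c' *s z = - ?c' *s K' ?y"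
      by (simp add: op_simps K_inverse c scale_right_diff_distrib scale_powi_cancel del: scale_scale)
    have "K' ?y = ?c' *s ?y" using z K_weight_iff unfolding c by blast
    then have "K' (K' z - ?c' *s z) = ?c' *s (K' z - ?c' *s z)"
      unfolding y by (simp add: op_simps)
    then have "K' z = ?c' *s z" using swapped.K_semisimple_nonneg[of "- n" z] False by simp
    then show False using K_weight_iff c \<open>K z \<noteq> c *s z\<close> by blast
  qed
qed

theorem K_diagonalizable: "eigenspan K (range ((powi) v)) = UNIV"
proof -
  have "eigenspan K UNIV \<subseteq> eigenspan K (range ((powi) v))"
  proof
    fix x assume "x \<in> eigenspan K UNIV"
    then show "x \<in> eigenspan K (range ((powi) v))"
    proof (rule eigenspan_induct)
      fix y c assume y: "K y = c *s y"
      show "y \<in> eigenspan K (range ((powi) v))"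
      proof (cases "y = 0")
        case True
        then show ?thesis using subspace_0[OF subspace_eigenspan] by simp
      next
        case False
        then show ?thesis using type_one[OF False y] eigenspan_base[of K y c] y by blast
      qed
    qed simp
  qed
  then show ?thesis using eigenspan_UNIV_if_semisimple[OF operators(3) K_semisimple] by blast
qed

end


section \<open>Diagonalizability of the coideal generator\<close>

context quantum_sl2_module
begin

definition qnumber :: "int \<Rightarrow> 'a" where
  "qnumber n = (v powi n - v powi (- n)) / (v - inverse v)"

lemma qnumber_0 [simp]: "qnumber 0 = 0"
  by (simp add: qnumber_def)

text \<open>
\<open>(v\<^sup>m - v\<^sup>n) (1 + v\<^sup>-\<^sup>m\<^sup>-\<^sup>n)\<close> is the difference of the two numerators, and \<open>-1\<close> is not a power of \<open>v\<close>.
Distinctness of these numbers makes the triangular operator below diagonalizable.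
\<close>

lemma qnumber_inject: "qnumber m = qnumber n \<longleftrightarrow> m = n"
proof
  assume "qnumber m = qnumber n"
  then have eq: "v powi m - v powi (- m) = v powi n - v powi (- n)"
    using v_diff_nonzero by (simp add: qnumber_def)
  have "(v powi m - v powi n) * (1 + v powi (- m - n))
      = (v powi m - v powi (- m)) - (v powi n - v powi (- n))"
  proof -
    have "v powi m * v powi (- m - n) = v powi (- n)" "v powi n * v powi (- m - n) = v powi (- m)"
      unfolding powi_add[symmetric] by simp_all
    then show ?thesis by (simp only: distrib_left left_diff_distrib mult_1_right) simp
  qed
  then have "(v powi m - v powi n) * (1 + v powi (- m - n)) = 0" unfolding eq by simp
  moreover have "1 + v powi (- m - n) \<noteq> 0"
  proof
    assume *: "1 + v powi (- m - n) = 0"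
    then have minus: "v powi (- m - n) = - 1" by (simp add: add_eq_0_iff)
    then have "v powi ((- m - n) + (- m - n)) = 1" unfolding powi_add by simp
    then have "- m - n = 0" unfolding powi_eq_1_iff by simp
    then have "(2::'a) = 0" using * by simp
    then show False using two_nonzero by contradiction
  qed
  ultimately have "v powi m - v powi n = 0" by simp
  then show "m = n" by (simp only: powi_inject right_minus_eq)
qed simp

text \<open>
The identity behind the eigenvector recursion: its two summands come from \<open>F\<close> raising and from
\<open>E\<close> lowering the exponent of \<open>F\<close>.
\<close>

lemma qnumber_split: "qnumber k * v powi (k - n) + v powi k * qnumber (n - k) = qnumber n"
proof -
  have "(v powi k - v powi (- k)) * v powi (k - n) + v powi k * (v powi (n - k) - v powi (- (n - k)))
      = v powi n - v powi (- n)"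
    by (simp only: left_diff_distrib right_diff_distrib powi_add[symmetric]) simp
  then have "((v powi k - v powi (- k)) * v powi (k - n) + v powi k * (v powi (n - k) - v powi (- (n - k))))
      / (v - inverse v) = qnumber n" by (simp only: qnumber_def)
  then show ?thesis
    by (simp only: qnumber_def add_divide_distrib times_divide_eq_left times_divide_eq_right)
qed

lemma weight_F: "K x = v powi n *s x \<Longrightarrow> K (F x) = v powi (n - 2) *s F x"
  by (simp only: K_F op_simps scale_scale powi_add[symmetric]) simp

lemma weight_E: "K x = v powi n *s x \<Longrightarrow> K (E x) = v powi (n + 2) *s E x"
  by (simp only: K_E op_simps scale_scale powi_add[symmetric]) (simp add: add.commute)

lemma weight_F_power: "K x = v powi n *s x \<Longrightarrow> K ((F ^^ k) x) = v powi (n - 2 * int k) *s (F ^^ k) x"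
proof (induction k)
  case (Suc k)
  then show ?case using weight_F[of "(F ^^ k) x" "n - 2 * int k"] by (simp add: algebra_simps)
qed simp

lemma operator_F_power: "operator (F ^^ k)"
  by (rule operatorI; induction k) (simp_all add: op_simps)

lemma operator_K_power: "operator (K ^^ k)"
  by (rule operatorI; induction k) (simp_all add: op_simps)

lemma K_power_weight: "K x = v powi n *s x \<Longrightarrow> (K ^^ k) x = v powi (n * int k) *s x"
proof (induction k)
  case (Suc k)
  have "v powi (n * int (Suc k)) = v powi (n * int k) * v powi n"
    unfolding powi_add[symmetric] by (simp add: algebra_simps)
  then show ?case using Suc by (simp add: op_simps)
qed simp

text \<open>
\<open>E F\<^bsup>k+1\<^esup>\<close> and \<open>F\<^bsup>k+1\<^esup> E\<close> both are \<open>F\<^sup>k\<close> composed with a shifted Casimir operator, and the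
difference of two shifts is a scalar on a weight vector.
\<close>

lemma E_F_power:
  assumes "K x = v powi n *s x"
  shows "E ((F ^^ Suc k) x)
    = (F ^^ Suc k) (E x) + (qnumber (int k + 1) * qnumber (n - int k)) *s (F ^^ k) x"
proof -
  let ?j = "- 1 - 2 * int k"
  define \<delta> where "\<delta> = 1 / (v - inverse v)\<^sup>2"
  have K': "K' x = v powi (- n) *s x" using assms K_weight_iff by blast
  have "E ((F ^^ Suc k) x) = (F ^^ k) (shifted_casimir ?j x)"
    by (simp add: E_F shifted_casimir_F_power)
  moreover have "(F ^^ Suc k) (E x) = (F ^^ k) (shifted_casimir 1 x)"
    by (simp add: F_E funpow_swap1)
  ultimately have diff: "E ((F ^^ Suc k) x) - (F ^^ Suc k) (E x)
      = (F ^^ k) (shifted_casimir ?j x - shifted_casimir 1 x)"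
    by (simp only: operator_simps[OF operator_F_power])
  have 1: "(v powi 1 - v powi ?j) * (v powi n - v powi (- ?j - 1) * v powi (- n))
      = (v powi (int k + 1) - v powi (- (int k + 1))) * (v powi (n - int k) - v powi (- (n - int k)))"
    by (simp only: left_diff_distrib right_diff_distrib powi_add[symmetric]) (simp add: algebra_simps)
  have "shifted_casimir ?j x - shifted_casimir 1 x
      = (\<delta> * ((v powi 1 - v powi ?j) * (v powi n - v powi (- ?j - 1) * v powi (- n)))) *s x"
    unfolding shifted_casimir_diff assms K' \<delta>_def[symmetric]
    by (simp only: scale_scale scale_left_diff_distrib[symmetric] mult.assoc)
  also have "\<delta> * ((v powi 1 - v powi ?j) * (v powi n - v powi (- ?j - 1) * v powi (- n)))
      = qnumber (int k + 1) * qnumber (n - int k)"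
    unfolding 1 qnumber_def \<delta>_def by (simp add: power2_eq_square)
  finally show ?thesis
    using diff by (simp only: operator_simps[OF operator_F_power]) (metis add_diff_cancel_left' diff_add_cancel add.commute)
qed

end

text \<open>
The operator to be diagonalized is \<open>B = F + \<sigma> E K'\<close>; its eigenvalues will be the numbers
\<open>c [n]\<close>, which is why a square root \<open>c\<close> of \<open>\<sigma> v\<close> is fixed.
\<close>

locale coideal_generator = quantum_sl2_module +
  fixes \<sigma> c :: 'a
  assumes c_square: "c ^ 2 = \<sigma> * v" and c_nonzero: "c \<noteq> 0"
begin

definition coideal_op :: "'b \<Rightarrow> 'b" where
  "coideal_op x = F x + \<sigma> *s E (K' x)"

text \<open>
\<open>B\<close> shifts weights by \<open>\<plusminus>2\<close>. This operator has \<open>B\<close>'s raising part, but \<open>c (K - K') / (v - v\<^sup>-\<^sup>1)\<close> in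
place of the lowering part, and so it is triangular with the scalar \<open>c [n]\<close> on weight \<open>n\<close>.
\<close>

definition triangular_op :: "'b \<Rightarrow> 'b" where
  "triangular_op x = (c / (v - inverse v)) *s (K x - K' x) + \<sigma> *s E (K' x)"

lemma operator_coideal_op: "operator coideal_op"
  unfolding coideal_op_def by (rule operatorI) (simp_all add: op_simps scale_right_distrib mult_ac)

lemma operator_triangular_op: "operator triangular_op"
  unfolding triangular_op_def
  by (rule operatorI) (simp_all add: op_simps scale_right_distrib scale_right_diff_distrib mult_ac)

lemma triangular_op_weight:
  assumes "K x = v powi n *s x"
  shows "triangular_op x = (c * qnumber n) *s x + (\<sigma> * v powi (- n)) *s E x"
proof -
  have "K' x = v powi (- n) *s x" using assms K_weight_iff by blast
  then show ?thesis
    unfolding triangular_op_def assms qnumber_def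
    by (simp add: op_simps scale_left_diff_distrib[symmetric])
qed

text \<open>
The closed form is \<open>c\<^sup>-\<^sup>k v\<^bsup>-k(k+1)/2\<^esup> / [k]!\<close>, so \<open>gauge\<close> is a truncated \<open>q\<close>-exponential of a multiple
of \<open>FK\<close>. On a highest weight vector of weight \<open>n\<close> it produces the eigenvector of \<open>B\<close> with
eigenvalue \<open>c [n]\<close>, and this property determines the coefficients.
\<close>

primrec gauge_coeff :: "nat \<Rightarrow> 'a" where
  "gauge_coeff 0 = 1"
| "gauge_coeff (Suc k) = gauge_coeff k * v powi (- (int k + 1)) / (c * qnumber (int k + 1))"

definition gauge :: "nat \<Rightarrow> 'b \<Rightarrow> 'b" where
  "gauge N x = (\<Sum>k\<le>N. gauge_coeff k *s (F ^^ k) ((K ^^ k) x))"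

lemma operator_gauge: "operator (gauge N)"
  unfolding gauge_def
  by (rule operatorI)
    (simp_all add: operator_simps[OF operator_F_power] operator_simps[OF operator_K_power]
      scale_right_distrib sum.distrib scale_sum_right mult.commute)

lemma gauge_weight:
  assumes "K x = v powi n *s x"
  shows "gauge N x = (\<Sum>k\<le>N. (gauge_coeff k * v powi (n * int k)) *s (F ^^ k) x)"
  unfolding gauge_def
  by (simp add: K_power_weight[OF assms] operator_simps[OF operator_F_power])

lemma gauge_recursion:
  fixes n :: int
  defines "a \<equiv> \<lambda>k. gauge_coeff k * v powi (n * int k)"
  shows "a (Suc k) * (c * qnumber (int k + 1)) = a k * v powi (n - int k - 1)"
proof -
  have q: "c * qnumber (int k + 1) \<noteq> 0"
    using c_nonzero qnumber_inject[of "int k + 1" 0] by simp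
  have "a (Suc k) * (c * qnumber (int k + 1))
      = gauge_coeff k * (v powi (- (int k + 1)) * v powi (n * int (Suc k)))"
    unfolding a_def gauge_coeff.simps using q by simp
  also have "v powi (- (int k + 1)) * v powi (n * int (Suc k)) = v powi (n * int k) * v powi (n - int k - 1)"
    unfolding powi_add[symmetric] by (simp add: algebra_simps)
  finally show ?thesis by (simp add: a_def)
qed

text \<open>
Raising the weight by \<open>2\<close> multiplies the \<open>k\<close>-th coefficient of \<open>gauge\<close> by \<open>v\<^sup>2\<^sup>k\<close>, and the same factor
arises when \<open>K'\<close> passes \<open>F\<^sup>k\<close>. Therefore the terms containing \<open>E x\<close> assemble to \<open>gauge\<close> of a multiple
of \<open>E x\<close>. In the remaining terms the coefficient of \<open>F\<^sup>k x\<close> is \<open>c [n]\<close> times that in \<open>gauge N x\<close>, by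
the recursion of the coefficients and \<open>qnumber_split\<close>.
\<close>

lemma coideal_op_gauge_weight:
  assumes nil: "\<And>x. (F ^^ N) x = 0" and x: "K x = v powi n *s x"
  shows "coideal_op (gauge N x) = gauge N (triangular_op x)"
proof -
  define a where "a k = gauge_coeff k * v powi (n * int k)" for k
  define f where "f k = (F ^^ k) x" for k
  have rec: "a (Suc k) * (c * qnumber (int k + 1)) = a k * v powi (n - int k - 1)" for k
    unfolding a_def by (rule gauge_recursion)
  \<comment> \<open>These two vanish, so that truncating the sum at \<open>N\<close> does no harm.\<close>
  have fN: "f N = 0" "f (Suc N) = 0" by (simp_all add: f_def nil op_simps)
  \<comment> \<open>the coefficients of \<open>F\<^sup>k x\<close> that come from \<open>F\<close>, and in \<open>b (Suc k)\<close> those that come from \<open>E\<close>\<close>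
  define a' where "a' k = (case k of 0 \<Rightarrow> 0 | Suc l \<Rightarrow> a l)" for k
  define b where "b k = (case k of 0 \<Rightarrow> 0 | Suc l \<Rightarrow>
      \<sigma> * a k * v powi (2 * int k - n) * (qnumber (int l + 1) * qnumber (n - int l)))" for k
  have K'f: "K' (f k) = v powi (2 * int k - n) *s f k" for k
    using weight_F_power[OF x, of k] K_weight_iff[of "f k" "n - 2 * int k"] by (simp add: f_def)
  have coefficient: "a' k + b (Suc k) = c * qnumber n * a k" for k
  proof -
    have "a' k = a k * c * qnumber (int k) * v powi (int k - n)"
    proof (cases k)
      case (Suc l)
      have "a k * c * qnumber (int k) * v powi (int k - n)
          = a (Suc l) * (c * qnumber (int l + 1)) * v powi (int k - n)"
        by (simp add: Suc add.commute mult_ac)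
      also have "\<dots> = a l * (v powi (n - int l - 1) * v powi (int k - n))" by (simp add: rec)
      also have "\<dots> = a l" unfolding powi_add[symmetric] by (simp add: Suc)
      finally show ?thesis by (simp add: a'_def Suc)
    qed (simp add: a'_def)
    moreover have "b (Suc k) = a k * c * (v powi int k * qnumber (n - int k))"
    proof -
      have \<sigma>: "\<sigma> = c * c * v powi (- 1)"
        using c_square v_nonzero by (simp add: power_int_minus power2_eq_square field_simps)
      have "b (Suc k) = c * v powi (- 1) * v powi (2 * int (Suc k) - n) *
          (a (Suc k) * (c * qnumber (int k + 1))) * qnumber (n - int k)"
        unfolding b_def by (simp add: \<sigma> mult_ac)
      also have "\<dots> = a k * c * (v powi (- 1) * v powi (2 * int (Suc k) - n) * v powi (n - int k - 1)) *
          qnumber (n - int k)" unfolding rec by (simp only: mult_ac)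
      also have "v powi (- 1) * v powi (2 * int (Suc k) - n) * v powi (n - int k - 1) = v powi int k"
        unfolding powi_add[symmetric] by simp
      finally show ?thesis by (simp only: mult_ac)
    qed
    ultimately have "a' k + b (Suc k) = a k * c *
        (qnumber (int k) * v powi (int k - n) + v powi int k * qnumber (n - int k))"
      by (simp add: distrib_left mult_ac)
    then show ?thesis by (simp only: qnumber_split) (simp add: mult_ac)
  qed
  have Ef: "E (f k) = (F ^^ k) (E x) + (case k of 0 \<Rightarrow> 0 | Suc l \<Rightarrow>
      (qnumber (int l + 1) * qnumber (n - int l)) *s f l)" for k
    by (cases k) (simp add: f_def, simp only: f_def E_F_power[OF x] nat.case)
  have shiftF: "(\<Sum>k\<le>N. a k *s f (Suc k)) = (\<Sum>k\<le>N. a' k *s f k)"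
  proof -
    have "(\<Sum>k\<le>Suc N. a' k *s f k) = (\<Sum>k\<le>N. a k *s f (Suc k))"
      by (simp only: sum.atMost_Suc_shift) (simp add: a'_def)
    then show ?thesis using fN by simp
  qed
  have shiftE: "(\<Sum>k\<le>N. b k *s f (k - 1)) = (\<Sum>k\<le>N. b (Suc k) *s f k)"
  proof -
    have "(\<Sum>k\<le>N. b k *s f (k - 1)) = (\<Sum>k<Suc N. b k *s f (k - 1))"
      by (simp only: lessThan_Suc_atMost)
    also have "\<dots> = (\<Sum>k<N. b (Suc k) *s f k)"
      by (simp only: sum.lessThan_Suc_shift) (simp add: b_def)
    also have "\<dots> = (\<Sum>k<Suc N. b (Suc k) *s f k)" using fN by simp
    finally show ?thesis by (simp only: lessThan_Suc_atMost)
  qed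
  have term_E: "\<sigma> *s E (K' (a k *s f k))
      = (a k * \<sigma> * v powi (2 * int k - n)) *s (F ^^ k) (E x) + b k *s f (k - 1)" for k
    by (cases k) (simp_all add: op_simps K'f Ef b_def scale_right_distrib mult_ac)
  have E_part: "\<sigma> * v powi (- n) * (gauge_coeff k * v powi ((n + 2) * int k)) = a k * \<sigma> * v powi (2 * int k - n)" for k
  proof -
    have "v powi ((n + 2) * int k) * v powi (- n) = v powi (n * int k) * v powi (2 * int k - n)"
      unfolding powi_add[symmetric] by (simp add: algebra_simps)
    then show ?thesis by (simp add: a_def mult_ac)
  qed
  have "coideal_op (gauge N x) = (\<Sum>k\<le>N. F (a k *s f k) + \<sigma> *s E (K' (a k *s f k)))"
    unfolding gauge_weight[OF x] operator_sum[OF operator_coideal_op]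
    by (simp add: coideal_op_def a_def f_def)
  also have "\<dots> = (\<Sum>k\<le>N. a k *s f (Suc k)) + (\<Sum>k\<le>N. b k *s f (k - 1)) +
      (\<Sum>k\<le>N. (a k * \<sigma> * v powi (2 * int k - n)) *s (F ^^ k) (E x))"
    unfolding term_E sum.distrib by (simp add: f_def op_simps)
  also have "\<dots> = (\<Sum>k\<le>N. (a' k + b (Suc k)) *s f k) +
      (\<Sum>k\<le>N. (a k * \<sigma> * v powi (2 * int k - n)) *s (F ^^ k) (E x))"
    unfolding shiftF shiftE by (simp add: scale_left_distrib sum.distrib)
  also have "\<dots> = (c * qnumber n) *s gauge N x + (\<sigma> * v powi (- n)) *s gauge N (E x)"
    unfolding coefficient gauge_weight[OF x] gauge_weight[OF weight_E[OF x]] scale_sum_right scale_scale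
    by (simp only: a_def[symmetric] f_def E_part)
  also have "\<dots> = gauge N (triangular_op x)"
    by (simp add: triangular_op_weight[OF x] operator_simps[OF operator_gauge])
  finally show ?thesis .
qed

end

context coideal_generator
begin

text \<open>
Weight vectors span the module.
\<close>

lemma coideal_op_gauge:
  assumes "\<And>x. (F ^^ N) x = 0"
  shows "coideal_op (gauge N x) = gauge N (triangular_op x)"
proof -
  have "x \<in> {x. coideal_op (gauge N x) = gauge N (triangular_op x)}"
  proof (rule eigenspan_induct)
    show "x \<in> eigenspan K (range ((powi) v))" using K_diagonalizable by simp
    show "subspace {x. coideal_op (gauge N x) = gauge N (triangular_op x)}"
      by (rule subspaceI)
        (simp_all add: operator_simps[OF operator_coideal_op] operator_simps[OF operator_gauge]
          operator_simps[OF operator_triangular_op])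
  qed (use coideal_op_gauge_weight[OF assms] in auto)
  then show ?thesis by simp
qed

definition weights_ge :: "int \<Rightarrow> 'b set" where
  "weights_ge n = eigenspan K {v powi k | k. n \<le> k}"

definition weights_le :: "int \<Rightarrow> 'b set" where
  "weights_le n = eigenspan K {v powi k | k. k \<le> n}"

lemma weight_bound:
  obtains b :: int where "\<And>x n. x \<noteq> 0 \<Longrightarrow> K x = v powi n *s x \<Longrightarrow> \<bar>n\<bar> \<le> b"
proof -
  let ?W = "{n. \<exists>x. x \<noteq> 0 \<and> K x = v powi n *s x}"
  have "inj_on ((powi) v) ?W" by (rule inj_onI) (simp only: powi_inject)
  moreover have "finite ((powi) v ` ?W)"
    by (rule finite_subset[OF _ finite_eigenvalues[OF operators(3)]]) auto
  ultimately have "finite ?W" using finite_imageD by blast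
  then have "\<bar>n\<bar> \<le> Max (abs ` ?W)" if "n \<in> ?W" for n
    using that by (intro Max_ge) auto
  then show thesis by (intro that) blast
qed

text \<open>
\<open>gauge\<close> is unipotent: on a weight vector it adds only terms of lower weight to the identity.
The induction climbs through the weights, starting below the smallest one, where the space
is zero.
\<close>

lemma weights_le_subset_range_gauge:
  assumes nil: "\<And>x. (F ^^ N) x = 0" and b: "\<And>x n. x \<noteq> 0 \<Longrightarrow> K x = v powi n *s x \<Longrightarrow> \<bar>n\<bar> \<le> b"
  shows "weights_le (int j - b - 1) \<subseteq> range (gauge N)"
proof (induction j)
  case 0
  have range: "subspace (range (gauge N))"
    by (rule subspace_range[OF operator_gauge])
  show ?case
  proof
    fix x assume "x \<in> weights_le (int 0 - b - 1)"
    then show "x \<in> range (gauge N)"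
      unfolding weights_le_def
    proof (rule eigenspan_induct[OF _ range])
      fix y c' assume "c' \<in> {v powi k |k. k \<le> int 0 - b - 1}" "K y = c' *s y"
      then have "y = 0" using b[of y] by fastforce
      then show "y \<in> range (gauge N)" using range subspace_0 by blast
    qed
  qed
next
  case (Suc j)
  have range: "subspace (range (gauge N))"
    by (rule subspace_range[OF operator_gauge])
  show ?case
  proof
    fix x assume "x \<in> weights_le (int (Suc j) - b - 1)"
    then show "x \<in> range (gauge N)"
      unfolding weights_le_def
    proof (rule eigenspan_induct[OF _ range])
      fix y c' assume "c' \<in> {v powi k |k. k \<le> int (Suc j) - b - 1}" "K y = c' *s y"
      then obtain n where n: "n \<le> int (Suc j) - b - 1" "K y = v powi n *s y" by blast
      have "gauge N y - y = (\<Sum>k<N. (gauge_coeff (Suc k) * v powi (n * int (Suc k))) *s (F ^^ Suc k) y)"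
        unfolding gauge_weight[OF n(2)] by (simp add: sum.atMost_shift del: funpow.simps(2) of_nat_Suc gauge_coeff.simps(2))
      also have "\<dots> \<in> weights_le (int j - b - 1)"
      proof (unfold weights_le_def, intro subspace_sum subspace_scale subspace_eigenspan)
        fix k
        show "(F ^^ Suc k) y \<in> eigenspan K {v powi k |k. k \<le> int j - b - 1}"
          by (rule eigenspan_base[where T = K, OF weight_F_power[OF n(2)]]) (use n(1) in auto)
      qed
      finally have "gauge N y - y \<in> range (gauge N)" using Suc by blast
      then have "gauge N y - (gauge N y - y) \<in> range (gauge N)"
        by (rule subspace_diff[OF range rangeI])
      then show "y \<in> range (gauge N)" by simp
    qed
  qed
qed

lemma gauge_surj:
  assumes "\<And>x. (F ^^ N) x = 0"
  shows "surj (gauge N)"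
proof -
  obtain b where b: "\<And>x n. x \<noteq> 0 \<Longrightarrow> K x = v powi n *s x \<Longrightarrow> \<bar>n\<bar> \<le> b" using weight_bound by blast
  have "x \<in> range (gauge N)" for x
  proof (rule eigenspan_induct[of x K "range ((powi) v)"])
    show "x \<in> eigenspan K (range ((powi) v))" using K_diagonalizable by simp
    show range: "subspace (range (gauge N))"
      by (rule subspace_range[OF operator_gauge])
    fix y c' assume "c' \<in> range ((powi) v)" and y: "K y = c' *s y"
    then obtain n where n: "c' = v powi n" by blast
    show "y \<in> range (gauge N)"
    proof (cases "y = 0")
      case True
      then show ?thesis using range subspace_0 by blast
    next
      case False
      then have "n \<le> int (nat (2 * b + 1)) - b - 1" using b[of y n] y n by simp
      then have "y \<in> weights_le (int (nat (2 * b + 1)) - b - 1)"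
        unfolding weights_le_def by (intro eigenspan_base[where T = K, OF y]) (use n in blast)
      then show ?thesis using weights_le_subset_range_gauge[OF assms, of b "nat (2 * b + 1)"] b by blast
    qed
  qed
  then show ?thesis by blast
qed

lemma triangular_op_weights_ge:
  assumes "x \<in> weights_ge n"
  shows "triangular_op x - (c * qnumber n) *s x \<in> weights_ge (n + 1)"
proof -
  have sub: "subspace {x. triangular_op x - (c * qnumber n) *s x \<in> weights_ge (n + 1)}"
  proof (rule subspaceI)
    show "0 \<in> {x. triangular_op x - (c * qnumber n) *s x \<in> weights_ge (n + 1)}"
      by (simp add: operator_simps[OF operator_triangular_op] weights_ge_def subspace_0)
  next
    fix y z assume "y \<in> {x. triangular_op x - (c * qnumber n) *s x \<in> weights_ge (n + 1)}"
      "z \<in> {x. triangular_op x - (c * qnumber n) *s x \<in> weights_ge (n + 1)}"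
    then have "(triangular_op y - (c * qnumber n) *s y) + (triangular_op z - (c * qnumber n) *s z) \<in> weights_ge (n + 1)"
      unfolding weights_ge_def by (intro subspace_add) auto
    then show "y + z \<in> {x. triangular_op x - (c * qnumber n) *s x \<in> weights_ge (n + 1)}"
      by (simp add: operator_simps[OF operator_triangular_op] scale_right_distrib add_diff_add)
  next
    fix r y assume "y \<in> {x. triangular_op x - (c * qnumber n) *s x \<in> weights_ge (n + 1)}"
    then have "r *s (triangular_op y - (c * qnumber n) *s y) \<in> weights_ge (n + 1)"
      unfolding weights_ge_def by (intro subspace_scale) auto
    then show "r *s y \<in> {x. triangular_op x - (c * qnumber n) *s x \<in> weights_ge (n + 1)}"
      by (simp add: operator_simps[OF operator_triangular_op] scale_right_diff_distrib mult_ac)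
  qed
  have "x \<in> {x. triangular_op x - (c * qnumber n) *s x \<in> weights_ge (n + 1)}"
    using assms unfolding weights_ge_def
  proof (rule eigenspan_induct[OF _ sub[unfolded weights_ge_def]])
    fix y c' assume "c' \<in> {v powi k |k. n \<le> k}" "K y = c' *s y"
    then obtain k where k: "n \<le> k" "K y = v powi k *s y" by blast
    have y: "(c * qnumber k - c * qnumber n) *s y \<in> weights_ge (n + 1)"
    proof (cases "k = n")
      case True
      then show ?thesis by (simp add: weights_ge_def subspace_0)
    next
      case False
      then have "y \<in> weights_ge (n + 1)"
        unfolding weights_ge_def by (intro eigenspan_base[where T = K, OF k(2)]) (use k(1) in auto)
      then show ?thesis unfolding weights_ge_def by (intro subspace_scale subspace_eigenspan)
    qed
    have "E y \<in> weights_ge (n + 1)"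
      unfolding weights_ge_def by (intro eigenspan_base[where T = K, OF weight_E[OF k(2)]]) (use k(1) in auto)
    then have "(\<sigma> * v powi (- k)) *s E y \<in> weights_ge (n + 1)"
      unfolding weights_ge_def by (rule subspace_scale[OF subspace_eigenspan])
    with y have "(c * qnumber k - c * qnumber n) *s y + (\<sigma> * v powi (- k)) *s E y \<in> weights_ge (n + 1)"
      unfolding weights_ge_def by (rule subspace_add[OF subspace_eigenspan])
    then show "y \<in> {x. triangular_op x - (c * qnumber n) *s x \<in> eigenspan K {v powi k |k. n + 1 \<le> k}}"
      unfolding weights_ge_def
      by (simp add: triangular_op_weight[OF k(2)] scale_left_diff_distrib algebra_simps)
  qed
  then show ?thesis by simp
qed

text \<open>
\<open>gauge\<close> carries the flag by weight, on which the triangular operator acts with scalars \<open>c [n]\<close>, to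
a flag on which \<open>B\<close> acts with the same scalars. These are distinct, so the eigenvectors of \<open>B\<close>
exhaust the flag, by induction from the largest weight downwards; the last member of the flag
is the whole module because \<open>gauge\<close> is surjective.
\<close>

theorem coideal_op_diagonalizable: "eigenspan coideal_op (range (\<lambda>n. c * qnumber n)) = UNIV"
proof -
  obtain N where nil: "\<And>x. (F ^^ N) x = 0" using nilpotent by blast
  obtain b where b: "\<And>x n. x \<noteq> 0 \<Longrightarrow> K x = v powi n *s x \<Longrightarrow> \<bar>n\<bar> \<le> b" using weight_bound by blast
  have step: "gauge N x \<in> eigenspan coideal_op {c * qnumber k | k. b + 1 - int j \<le> k}"
    if "x \<in> weights_ge (b + 1 - int j)" for x j
    using that
  proof (induction j arbitrary: x)
    case 0
    have "x \<in> {0}"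
      using 0 unfolding weights_ge_def
    proof (rule eigenspan_induct)
      fix y c' assume "c' \<in> {v powi k |k. b + 1 - int 0 \<le> k}" "K y = c' *s y"
      then show "y \<in> {0}" using b[of y] by fastforce
    qed simp
    then show ?case by (simp add: operator_simps[OF operator_gauge] subspace_0)
  next
    case (Suc j)
    define n where "n = b + 1 - int (Suc j)"
    have n1: "n + 1 = b + 1 - int j" by (simp add: n_def)
    have "coideal_op (gauge N x) - (c * qnumber n) *s gauge N x
        = gauge N (triangular_op x - (c * qnumber n) *s x)"
      by (simp add: coideal_op_gauge[OF nil] operator_simps[OF operator_gauge])
    also have "\<dots> \<in> eigenspan coideal_op {c * qnumber k | k. n + 1 \<le> k}"
      using Suc.IH triangular_op_weights_ge[of x n] Suc.prems unfolding n_def[symmetric] n1 by blast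
    finally have "gauge N x \<in> eigenspan coideal_op (insert (c * qnumber n) {c * qnumber k | k. n + 1 \<le> k})"
      by (intro eigenspan_step[OF operator_coideal_op]) (auto simp: c_nonzero qnumber_inject)
    moreover have "insert (c * qnumber n) {c * qnumber k | k. n + 1 \<le> k} \<subseteq> {c * qnumber k | k. n \<le> k}"
      by auto
    ultimately show ?case unfolding n_def using eigenspan_mono by blast
  qed
  have "y \<in> eigenspan coideal_op (range (\<lambda>n. c * qnumber n))" for y
  proof -
    obtain x where y: "y = gauge N x" using gauge_surj[OF nil] by blast
    \<comment> \<open>After \<open>2 b + 1\<close> steps the flag starts at the smallest possible weight \<open>- b\<close>.\<close>
    let ?j = "nat (2 * b + 1)"
    have "x \<in> weights_ge (b + 1 - int ?j)"
    proof (rule eigenspan_induct[of x K "range ((powi) v)"])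
      show "x \<in> eigenspan K (range ((powi) v))" using K_diagonalizable by simp
      show sub: "subspace (weights_ge (b + 1 - int ?j))" by (simp add: weights_ge_def)
      fix z c' assume "c' \<in> range ((powi) v)" and z: "K z = c' *s z"
      then obtain n where n: "c' = v powi n" by blast
      show "z \<in> weights_ge (b + 1 - int ?j)"
      proof (cases "z = 0")
        case True
        then show ?thesis using sub subspace_0 by blast
      next
        case False
        then have "b + 1 - int ?j \<le> n" using b[of z n] z n by simp
        then show ?thesis unfolding weights_ge_def by (intro eigenspan_base[where T = K, OF z]) (use n in blast)
      qed
    qed
    then have "y \<in> eigenspan coideal_op {c * qnumber k | k. b + 1 - int ?j \<le> k}"
      using step y by blast
    moreover have "{c * qnumber k | k. b + 1 - int ?j \<le> k} \<subseteq> range (\<lambda>n. c * qnumber n)" by blast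
    ultimately show ?thesis using eigenspan_mono by blast
  qed
  then show ?thesis by blast
qed

end


section \<open>Functions that are regular at q = 1\<close>

text \<open>
Only power series in \<open>t = q - 1\<close> arise: \<open>q\<^bsup>1/n\<^esup> - 1\<close> is such a series without constant term, and
\<open>n = 1\<close> gives all of them.
\<close>

lemma K1_iff: "x \<in> K1 \<Phi> \<longleftrightarrow> (\<exists>A. \<Phi> x = to_ac (fps_to_fls A))"
proof
  assume "\<exists>A. \<Phi> x = to_ac (fps_to_fls A)"
  then obtain A where A: "\<Phi> x = to_ac (fps_to_fls A)" by blast
  have "has_expansion \<Phi> x 1 A" by (simp add: has_expansion_def A fps_binomial_1)
  then show "x \<in> K1 \<Phi>" unfolding K1_def by blast
qed (auto simp: K1_def has_expansion_def)

lemma K1_I: "\<Phi> x = to_ac (fps_to_fls A) \<Longrightarrow> x \<in> K1 \<Phi>"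
  using K1_iff by blast

lemma q_nonzero: "q \<noteq> 0"
  by (simp add: q_def)

context
  fixes \<Phi> :: "K \<Rightarrow> complex fls alg_closure"
  assumes expansion: "expansion_at_one \<Phi>"
begin

lemma expansion_add: "\<Phi> (x + y) = \<Phi> x + \<Phi> y"
  and expansion_mult: "\<Phi> (x * y) = \<Phi> x * \<Phi> y"
  and expansion_q: "\<Phi> q = to_ac (fps_to_fls (1 + fps_X))"
  using expansion by (simp_all add: expansion_at_one_def)

lemma expansion_0: "\<Phi> 0 = 0"
  using expansion_add[of 0 0] by simp

lemma expansion_1: "\<Phi> 1 = 1"
proof -
  have "const_K 1 = 1" by (simp add: const_K_def flip: one_pCons)
  then show ?thesis using expansion by (auto simp: expansion_at_one_def dest!: spec[of _ 1])
qed

lemma expansion_minus: "\<Phi> (- x) = - \<Phi> x"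
  using expansion_add[of x "- x"] by (simp add: expansion_0 eq_neg_iff_add_eq_0 add.commute)

lemma expansion_power: "\<Phi> (x ^ n) = \<Phi> x ^ n"
  by (induction n) (simp_all add: expansion_1 expansion_mult)

lemma expansion_inverse: "\<Phi> (inverse x) = inverse (\<Phi> x)"
proof (cases "x = 0")
  case False
  then have "\<Phi> x * \<Phi> (inverse x) = 1" by (simp add: expansion_1 flip: expansion_mult)
  then show ?thesis by (simp add: inverse_unique)
qed (simp add: expansion_0)

lemma K1_0: "0 \<in> K1 \<Phi>"
  by (rule K1_I[of _ _ 0]) (simp add: expansion_0)

lemma K1_1: "1 \<in> K1 \<Phi>"
  by (rule K1_I[of _ _ 1]) (simp add: expansion_1)

lemma K1_add: "x \<in> K1 \<Phi> \<Longrightarrow> y \<in> K1 \<Phi> \<Longrightarrow> x + y \<in> K1 \<Phi>"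
  unfolding K1_iff by (auto simp: expansion_add simp flip: fps_to_fls_plus to_ac_add)

lemma K1_mult: "x \<in> K1 \<Phi> \<Longrightarrow> y \<in> K1 \<Phi> \<Longrightarrow> x * y \<in> K1 \<Phi>"
  unfolding K1_iff by (auto simp: expansion_mult simp flip: fls_times_fps_to_fls to_ac_mult)

lemma K1_minus: "x \<in> K1 \<Phi> \<Longrightarrow> - x \<in> K1 \<Phi>"
  unfolding K1_iff by (auto simp: expansion_minus simp flip: fps_to_fls_uminus to_ac_minus)

lemma K1_power: "x \<in> K1 \<Phi> \<Longrightarrow> x ^ n \<in> K1 \<Phi>"
  by (induction n) (simp_all add: K1_1 K1_mult)

lemma K1_sum: "(\<And>i. i \<in> I \<Longrightarrow> f i \<in> K1 \<Phi>) \<Longrightarrow> (\<Sum>i\<in>I. f i) \<in> K1 \<Phi>"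
  by (induction I rule: infinite_finite_induct) (simp_all add: K1_0 K1_add)

lemma K1_inverse:
  assumes "\<Phi> x = to_ac (fps_to_fls A)" "fps_nth A 0 \<noteq> 0"
  shows "inverse x \<in> K1 \<Phi>"
  by (rule K1_I[of _ _ "inverse A"])
    (simp add: expansion_inverse assms fls_inverse_fps_to_fls subdegree_eq_0 flip: to_ac_inverse)

lemma q_in_K1: "q \<in> K1 \<Phi>" and inverse_q_in_K1: "inverse q \<in> K1 \<Phi>"
  using K1_I[of \<Phi> q, OF expansion_q] K1_inverse[OF expansion_q] by simp_all

lemma q_powi_in_K1: "q powi n \<in> K1 \<Phi>"
  using q_in_K1 inverse_q_in_K1 by (simp add: power_int_def K1_power)

lemma q_generic:
  assumes "q ^ n = 1"
  shows "n = 0"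
proof -
  have "\<Phi> (q ^ n) = to_ac (fps_to_fls ((1 + fps_X) ^ n))"
    by (simp add: expansion_power expansion_q fps_to_fls_power)
  then have "to_ac (fps_to_fls 1) = to_ac (fps_to_fls ((1 + fps_X :: complex fps) ^ n))"
    by (simp only: assms expansion_1 fps_one_to_fls to_ac_1)
  then have "(1 + fps_X) ^ n = (1 :: complex fps)" by (simp only: to_ac_eq_iff fps_to_fls_eq_iff)
  then have "fps_nth (fps_binomial (of_nat n :: complex)) 1 = fps_nth 1 1" by (simp only: fps_binomial_of_nat)
  then show ?thesis by simp
qed

lemma two_nonzero_K: "(2 :: K) \<noteq> 0"
proof
  assume "(2 :: K) = 0"
  then have "\<Phi> (1 + 1) = \<Phi> 0" by (simp add: one_add_one)
  then have "to_ac (1 + 1 :: complex fls) = 0" by (simp only: expansion_add expansion_1 expansion_0 to_ac_add to_ac_1)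
  then show False by (simp add: one_add_one)
qed

text \<open>
Both numerator and denominator are divisible by \<open>q - 1\<close>. The cofactor of the denominator is
\<open>1 + q + \<dots> + q\<^sup>d\<^sup>-\<^sup>1\<close>, with value \<open>d \<noteq> 0\<close> at \<open>q = 1\<close>.
\<close>

lemma q_quotient_in_K1:
  assumes "d > 0"
  shows "(q powi m - 1) / (q ^ d - 1) \<in> K1 \<Phi>"
proof -
  let ?S = "\<lambda>n. \<Sum>i<n. q ^ i"
  have S: "?S n \<in> K1 \<Phi>" for n by (intro K1_sum K1_power q_in_K1)
  have geom: "q ^ n - 1 = (q - 1) * ?S n" for n by (rule power_diff_1_eq)
  have q1: "q - 1 \<noteq> 0" using q_generic[of 1] by auto
  have "\<exists>s\<in>K1 \<Phi>. q powi m - 1 = (q - 1) * s"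
  proof (cases "m \<ge> 0")
    case True
    then show ?thesis using geom S by (auto simp: power_int_def)
  next
    case False
    let ?n = "nat (- m)"
    have "q powi m * q ^ ?n = 1" using False q_nonzero by (simp add: power_int_def power_inverse)
    then have "q powi m - 1 = - (q powi m) * (q ^ ?n - 1)" by (simp add: right_diff_distrib)
    also have "\<dots> = (q - 1) * (- (q powi m) * ?S ?n)" unfolding geom by (simp only: mult_ac)
    finally have "q powi m - 1 = (q - 1) * (- (q powi m) * ?S ?n)" .
    then show ?thesis by (intro bexI[of _ "- (q powi m) * ?S ?n"] K1_mult K1_minus q_powi_in_K1 S)
  qed
  then obtain s where s: "s \<in> K1 \<Phi>" "q powi m - 1 = (q - 1) * s" by blast
  have "\<Phi> (?S n) = to_ac (fps_to_fls (\<Sum>i<n. (1 + fps_X) ^ i))" for n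
    by (induction n)
      (simp_all add: expansion_0 expansion_add expansion_power expansion_q fps_to_fls_power)
  moreover have "fps_nth (\<Sum>i<d. (1 + fps_X :: complex fps) ^ i) 0 \<noteq> 0"
    using assms by (simp add: fps_sum_nth fps_nth_power_0)
  ultimately have "inverse (?S d) \<in> K1 \<Phi>" by (rule K1_inverse)
  moreover have "(q powi m - 1) / (q ^ d - 1) = s * inverse (?S d)"
    unfolding s(2) geom using q1 by (simp add: divide_inverse)
  ultimately show ?thesis using K1_mult[OF s(1)] by simp
qed

lemma K1_units_expansion:
  assumes "x \<in> K1_units \<Phi>"
  obtains A where "\<Phi> x = to_ac (fps_to_fls A)" "fps_nth A 0 \<noteq> 0"
proof -
  obtain y where y: "x \<in> K1 \<Phi>" "y \<in> K1 \<Phi>" "x * y = 1" using assms by (auto simp: K1_units_def)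
  obtain A B where AB: "\<Phi> x = to_ac (fps_to_fls A)" "\<Phi> y = to_ac (fps_to_fls B)"
    using y(1,2) by (auto simp: K1_iff)
  have "to_ac (fps_to_fls (A * B)) = to_ac (fps_to_fls 1)"
    using arg_cong[OF y(3), of \<Phi>] by (simp add: expansion_mult expansion_1 AB fls_times_fps_to_fls)
  then have "A * B = 1" by (simp only: to_ac_eq_iff fps_to_fls_eq_iff)
  then have "fps_nth A 0 * fps_nth B 0 = 1" by (metis fps_mult_nth_0 fps_one_nth)
  then show thesis using that AB(1) by force
qed

text \<open>
A power series with nonzero constant term has a square root among the power series, and the
expansion of \<open>c\<close> is one of the two roots.
\<close>

lemma sqrt_in_K1:
  assumes "c ^ 2 = x" "\<Phi> x = to_ac (fps_to_fls A)" "fps_nth A 0 \<noteq> 0"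
  shows "c \<in> K1 \<Phi>"
proof -
  define R where "R = fps_radical (\<lambda>_. csqrt) (Suc 1) A"
  have "R ^ Suc 1 = A"
    unfolding R_def using power_radical[OF assms(3), of "\<lambda>_. csqrt" 1] by (simp add: power2_csqrt numeral_2_eq_2[symmetric])
  then have R: "R\<^sup>2 = A" by (simp add: numeral_2_eq_2)
  have "(\<Phi> c)\<^sup>2 = (to_ac (fps_to_fls R))\<^sup>2"
    using assms(1,2) by (simp add: R[symmetric] fps_to_fls_power flip: expansion_power)
  then have "\<Phi> c = to_ac (fps_to_fls R) \<or> \<Phi> c = to_ac (fps_to_fls (- R))"
    by (simp add: power2_eq_iff)
  then show ?thesis using K1_I by blast
qed

lemma unit_times_q_power_expansion:
  assumes "x \<in> K1_units \<Phi>"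
  obtains A where "\<Phi> (x * q ^ n) = to_ac (fps_to_fls A)" "fps_nth A 0 \<noteq> 0"
proof -
  obtain A where A: "\<Phi> x = to_ac (fps_to_fls A)" "fps_nth A 0 \<noteq> 0" using K1_units_expansion[OF assms] .
  show thesis
  proof
    show "\<Phi> (x * q ^ n) = to_ac (fps_to_fls (A * (1 + fps_X) ^ n))"
      by (simp add: expansion_mult expansion_power expansion_q A(1) fls_times_fps_to_fls fps_to_fls_power)
    show "fps_nth (A * (1 + fps_X) ^ n) 0 \<noteq> 0" using A(2) by (simp add: fps_nth_power_0)
  qed
qed

end


section \<open>Modules over the quantum group\<close>

lemma ring_of_type_algebra_simps:
  "carrier ring_of_type_algebra = UNIV" "x \<otimes>\<^bsub>ring_of_type_algebra\<^esub> y = x * y"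
  "x \<oplus>\<^bsub>ring_of_type_algebra\<^esub> y = x + y" "\<one>\<^bsub>ring_of_type_algebra\<^esub> = 1"
  "\<zero>\<^bsub>ring_of_type_algebra\<^esub> = 0"
  by (simp_all add: ring_of_type_algebra_def)

lemma ring_of_type_ring_1: "ring (ring_of_type_algebra :: ('a :: Rings.ring_1) ring)"
proof (rule ringI)
  show "abelian_group (ring_of_type_algebra :: 'a ring)"
  proof (rule abelian_groupI)
    show "\<exists>y\<in>carrier ring_of_type_algebra. y \<oplus>\<^bsub>ring_of_type_algebra\<^esub> x = \<zero>\<^bsub>ring_of_type_algebra\<^esub>" for x :: 'a
      by (rule bexI[of _ "- x"]) (simp_all add: ring_of_type_algebra_simps)
  qed (simp_all add: ring_of_type_algebra_simps add_ac)
  show "Group.monoid (ring_of_type_algebra :: 'a ring)"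
    by (rule monoidI) (simp_all add: ring_of_type_algebra_simps mult.assoc)
qed (simp_all add: ring_of_type_algebra_simps distrib_left distrib_right)

lemma relation_ideal: "ideal (relation_ideal a d) ring_of_type_algebra"
  unfolding relation_ideal_def
  by (rule ring.genideal_ideal[OF ring_of_type_ring_1]) (simp add: ring_of_type_algebra_simps)

lemma quantum_group_ring: "ring (quantum_group a d)"
  unfolding quantum_group_def by (rule ideal.quotient_is_ring[OF relation_ideal])

lemma cls_ring_hom: "cls a d \<in> ring_hom ring_of_type_algebra (quantum_group a d)"
  unfolding quantum_group_def using ideal.rcos_ring_hom[OF relation_ideal, of a d]
  by (simp add: cls_def[abs_def])

lemma cls_simps:
  "cls a d x \<in> carrier (quantum_group a d)"
  "cls a d (x * y) = cls a d x \<otimes>\<^bsub>quantum_group a d\<^esub> cls a d y"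
  "cls a d (x + y) = cls a d x \<oplus>\<^bsub>quantum_group a d\<^esub> cls a d y"
  "cls a d 1 = \<one>\<^bsub>quantum_group a d\<^esub>"
  using ring_hom_memE[OF cls_ring_hom[of a d]] by (simp_all add: ring_of_type_algebra_simps)

lemma cls_relator:
  assumes "r \<in> relators a d"
  shows "cls a d r = cls a d 0"
proof -
  have "r \<in> relation_ideal a d"
    unfolding relation_ideal_def
    using ring.genideal_self[OF ring_of_type_ring_1, of "relators a d"] assms
    by (auto simp: ring_of_type_algebra_simps)
  moreover have "0 \<in> relation_ideal a d"
    using additive_subgroup.zero_closed[OF ideal.axioms(1)[OF relation_ideal], of a d] 
    by (simp add: ring_of_type_algebra_simps)
  moreover have "abelian_subgroup (relation_ideal a d) ring_of_type_algebra"
    by (rule abelian_subgroupI3[OF ideal.axioms(1)[OF relation_ideal] ring.is_abelian_group[OF ring_of_type_ring_1]])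
  ultimately show ?thesis
    unfolding cls_def by (metis abelian_subgroup.a_rcos_const)
qed

lemma cls_surj:
  assumes "u \<in> carrier (quantum_group a d)"
  obtains x where "u = cls a d x"
  using assms unfolding quantum_group_def cls_def FactRing_def A_RCOSETS_def'
  by (auto simp: ring_of_type_algebra_simps)

lemma generated_subalgebra_subset_carrier: "generated_subalgebra a d S \<subseteq> carrier (quantum_group a d)"
  unfolding generated_subalgebra_def
  by (rule ring.generate_ring_incl[OF quantum_group_ring]) (auto simp: cls_simps)

lemma subst_gvar: "subst \<phi> (gvar g) = \<phi> g"
proof -
  have "scal 1 = (1 :: 'a free_alg)" by (simp add: scal_def)
  then show ?thesis by (simp add: subst_def gvar_def)
qed

text \<open>
For \<open>a i j = 0\<close> the sum defining \<open>T\<^sub>i (E\<^sub>j)\<close> has the single term \<open>E\<^sub>j\<close>.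
\<close>

lemma lusztig_fixes_E:
  assumes "\<And>i. i \<in> set ws \<Longrightarrow> i \<noteq> j \<and> a i j = 0"
  shows "lusztig a d ws (E j) = E j"
  using assms
proof (induction ws)
  case Nil
  show ?case by (simp add: lusztig_def)
next
  case (Cons i ws)
  have scal1: "scal 1 = (1 :: 'a free_alg)" by (simp add: scal_def)
  have "i \<noteq> j" "a i j = 0" using Cons.prems[of i] by auto
  then have "subst (lusztig_gen a d i) (E j) = E j"
    by (auto simp add: subst_gvar divided_power_def qfact_def scal1 Let_def)
  then show ?case using Cons by (simp add: lusztig_def)
qed

locale quantum_group_module = finite_dim_operator_space sM
  for a :: "'i::finite \<Rightarrow> 'i \<Rightarrow> int" and d :: "'i \<Rightarrow> nat"
    and sM :: "K \<Rightarrow> 'm::ab_group_add \<Rightarrow> 'm" and act :: "'i free_alg set \<Rightarrow> 'm \<Rightarrow> 'm" +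
  assumes module: "U_module a d sM act"
begin

text \<open>
The action is pulled back to the free algebra, where the relations become identities between
operators on generators.
\<close>

definition free_act :: "'i free_alg \<Rightarrow> 'm \<Rightarrow> 'm" where
  "free_act x = act (cls a d x)"

lemma operator_act: "u \<in> carrier (quantum_group a d) \<Longrightarrow> operator (act u)"
  using module by (simp add: U_module_def algebra_module_def)

lemma operator_free_act: "operator (free_act x)"
  unfolding free_act_def by (rule operator_act[OF cls_simps(1)])

lemmas act_simps = operator_free_act[THEN operator_simps(1)] operator_free_act[THEN operator_simps(2)]
  operator_free_act[THEN operator_simps(3)] operator_free_act[THEN operator_simps(4)]
  operator_free_act[THEN operator_simps(5)]

lemma free_act_add: "free_act (x + y) m = free_act x m + free_act y m"
  and free_act_mult: "free_act (x * y) m = free_act x (free_act y m)"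
  and free_act_1: "free_act 1 m = m"
  and free_act_scal: "free_act (scal c) m = sM c m"
  using module by (simp_all add: free_act_def U_module_def algebra_module_def cls_simps)

lemma free_act_0: "free_act 0 m = 0"
  using free_act_add[of 0 0 m] by simp

lemma free_act_minus: "free_act (- x) m = - free_act x m"
  using free_act_add[of x "- x" m] by (simp add: free_act_0 eq_neg_iff_add_eq_0 add.commute)

lemma free_act_diff: "free_act (x - y) m = free_act x m - free_act y m"
  using free_act_add[of x "- y" m] by (simp add: free_act_minus)

lemmas free_act_simps = free_act_add free_act_mult free_act_1 free_act_scal free_act_0
  free_act_minus free_act_diff

lemma free_act_relator: "x - y \<in> relators a d \<Longrightarrow> free_act x m = free_act y m"
proof -
  assume "x - y \<in> relators a d"
  then have "free_act (x - y) m = 0"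
    using cls_relator free_act_0[of m] unfolding free_act_def by metis
  then show ?thesis by (simp add: free_act_diff)
qed

lemma K_Kinv: "free_act (Ki i) (free_act (Kinv i) m) = m" "free_act (Kinv i) (free_act (Ki i) m) = m"
proof -
  have "Ki i * Kinv i - 1 \<in> relators a d" "Kinv i * Ki i - 1 \<in> relators a d"
    unfolding relators_def by blast+
  from this[THEN free_act_relator, of m]
  show "free_act (Ki i) (free_act (Kinv i) m) = m" "free_act (Kinv i) (free_act (Ki i) m) = m"
    by (simp_all add: free_act_simps)
qed

lemma K_K: "free_act (Ki i) (free_act (Ki j) m) = free_act (Ki j) (free_act (Ki i) m)"
proof -
  have "Ki i * Ki j - Ki j * Ki i \<in> relators a d" unfolding relators_def by blast
  from free_act_relator[OF this, of m] show ?thesis by (simp add: free_act_simps)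
qed

lemma K_E: "free_act (Ki i) (free_act (E j) m) = sM ((q ^ d i) powi a i j) (free_act (E j) (free_act (Ki i) m))"
proof -
  have "Ki i * E j - scal ((q ^ d i) powi a i j) * E j * Ki i \<in> relators a d" unfolding relators_def by blast
  from free_act_relator[OF this, of m] show ?thesis by (simp add: free_act_simps)
qed

lemma K_F: "free_act (Ki i) (free_act (F j) m) = sM ((q ^ d i) powi (- a i j)) (free_act (F j) (free_act (Ki i) m))"
proof -
  have "Ki i * F j - scal ((q ^ d i) powi (- a i j)) * F j * Ki i \<in> relators a d" unfolding relators_def by blast
  from free_act_relator[OF this, of m] show ?thesis by (simp add: free_act_simps)
qed

lemma E_F_commute:
  assumes "i \<noteq> j"
  shows "free_act (E i) (free_act (F j) m) = free_act (F j) (free_act (E i) m)"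
proof -
  have "E i * F j - F j * E i - (if i = j then qbracket (q ^ d i) 0 (Ki i) (Kinv i) else 0) \<in> relators a d"
    unfolding relators_def by blast
  then have "E i * F j - F j * E i \<in> relators a d" using assms by simp
  from free_act_relator[OF this, of m] show ?thesis by (simp add: free_act_simps)
qed

lemma E_F_commutator:
  "free_act (E i) (free_act (F i) m) - free_act (F i) (free_act (E i) m)
    = sM (1 / (q ^ d i - inverse (q ^ d i))) (free_act (Ki i) m - free_act (Kinv i) m)"
proof -
  have "E i * F i - F i * E i - (if i = i then qbracket (q ^ d i) 0 (Ki i) (Kinv i) else 0) \<in> relators a d"
    unfolding relators_def by blast
  then have "E i * F i - F i * E i - qbracket (q ^ d i) 0 (Ki i) (Kinv i) \<in> relators a d" by simp
  from free_act_relator[OF this, of m] show ?thesis by (simp add: free_act_simps qbracket_def)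
qed

text \<open>
For \<open>a i j = 0\<close> the Serre relation is the commutator of two generators; the assumption on \<open>q\<close> makes
the \<open>q\<close>-integer \<open>[1]\<close> equal to \<open>1\<close> rather than to \<open>0 / 0\<close>.
\<close>

lemma serre_commute:
  assumes "i \<noteq> j" "a i j = 0" "G = GE \<or> G = GF" and v: "q ^ d i - inverse (q ^ d i) \<noteq> 0"
  shows "free_act (gvar (G i)) (free_act (gvar (G j)) m) = free_act (gvar (G j)) (free_act (gvar (G i)) m)"
proof -
  have "serre a d G i j \<in> relators a d" using assms unfolding relators_def by blast
  moreover have "divided_power (q ^ d i) x 0 = 1" "divided_power (q ^ d i) x (Suc 0) = x" for x :: "'i free_alg"
    using v by (simp_all add: divided_power_def qfact_def qint_def scal_def)
  moreover have "scal 1 = (1 :: 'i free_alg)" "scal (- 1) = (- 1 :: 'i free_alg)"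
    by (simp_all add: scal_def single_uminus)
  ultimately have "gvar (G j) * gvar (G i) - gvar (G i) * gvar (G j) \<in> relators a d"
    by (simp add: serre_def assms(2) Let_def)
  from free_act_relator[OF this, of m] show ?thesis by (simp add: free_act_simps)
qed

end


section \<open>The torus of the iquantum group\<close>

locale symmetric_pair_module = quantum_group_module a d sM act
  for a :: "'i::finite \<Rightarrow> 'i \<Rightarrow> int" and d :: "'i \<Rightarrow> nat"
    and sM :: "K \<Rightarrow> 'm::ab_group_add \<Rightarrow> 'm" and act :: "'i free_alg set \<Rightarrow> 'm \<Rightarrow> 'm" +
  fixes J S :: "'i set" and \<tau> :: "'i \<Rightarrow> 'i" and ws :: "'i list"
    and \<Phi> :: "K \<Rightarrow> complex fls alg_closure" and \<sigma> :: "'i \<Rightarrow> K"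
  assumes expansion: "expansion_at_one \<Phi>"
    and diagonal: "a i i = 2" and symmetrizer: "symmetrizer a d"
    and involution: "\<tau> (\<tau> i) = i" and automorphism: "a (\<tau> i) (\<tau> j) = a i j"
    and word: "set ws \<subseteq> J"
    and units: "i \<notin> J \<Longrightarrow> \<sigma> i \<in> K1_units \<Phi>"
    and marking: "admissible_marking a J \<tau> S"
    and type_one: "type_one a d sM act"
begin

lemma d_pos: "d i > 0" and d_symmetric: "int (d i) * a i j = int (d j) * a j i"
  using symmetrizer by (simp_all add: symmetrizer_def)

lemma marked:
  "j \<in> S \<Longrightarrow> \<tau> j = j" "i \<in> S \<Longrightarrow> j \<in> S \<Longrightarrow> i \<noteq> j \<Longrightarrow> a i j = 0"
  "i \<in> J \<Longrightarrow> j \<in> S \<Longrightarrow> a i j = 0" "j \<in> S \<Longrightarrow> j \<notin> J"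
  using marking diagonal[of j] by (auto simp: admissible_marking_def)

lemma type_one': "x \<noteq> 0 \<Longrightarrow> free_act (Ki i) x = sM c x \<Longrightarrow> \<exists>n::int. c = (q ^ d i) powi n"
  using type_one by (auto simp: type_one_def free_act_def)

sublocale sl2: quantum_sl2_module sM "q ^ d i" "free_act (E i)" "free_act (F i)" "free_act (Ki i)" "free_act (Kinv i)"
  for i
proof (intro quantum_sl2_module.intro quantum_sl2_module_axioms.intro finite_dim_operator_space_axioms)
  show "q ^ d i \<noteq> 0" using q_nonzero by simp
  show "n = 0" if "(q ^ d i) ^ n = 1" for n
    using q_generic[OF expansion, of "d i * n"] that d_pos[of i] by (simp add: power_mult)
  show "(2 :: K) \<noteq> 0" by (rule two_nonzero_K[OF expansion])
  show "free_act (Ki i) (free_act (E i) x) = sM ((q ^ d i) powi 2) (free_act (E i) (free_act (Ki i) x))" for x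
    using K_E[of i i x] by (simp only: diagonal)
  show "free_act (Ki i) (free_act (F i) x) = sM ((q ^ d i) powi - 2) (free_act (F i) (free_act (Ki i) x))" for x
    using K_F[of i i x] by (simp only: diagonal)
qed (rule operator_free_act K_Kinv E_F_commutator | erule (1) type_one')+

lemma Kinv_K: "free_act (Kinv i) (free_act (Ki j) m) = free_act (Ki j) (free_act (Kinv i) m)"
proof -
  have "free_act (Kinv i) (free_act (Ki j) (free_act (Ki i) (free_act (Kinv i) m)))
      = free_act (Kinv i) (free_act (Ki i) (free_act (Ki j) (free_act (Kinv i) m)))" by (simp only: K_K)
  then show ?thesis by (simp only: K_Kinv)
qed

lemma Kinv_Kinv: "free_act (Kinv i) (free_act (Kinv j) m) = free_act (Kinv j) (free_act (Kinv i) m)"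
proof -
  have "free_act (Kinv i) (free_act (Kinv j) (free_act (Ki i) (free_act (Kinv i) m)))
      = free_act (Kinv i) (free_act (Ki i) (free_act (Kinv j) (free_act (Kinv i) m)))" by (simp only: Kinv_K)
  then show ?thesis by (simp only: K_Kinv)
qed

lemma qd_powi: "(q ^ d i) powi n = q powi (int (d i) * n)"
  by (simp add: power_int_mult)

lemma K_E': "free_act (Ki i) (free_act (E j) m) = sM (q powi (int (d i) * a i j)) (free_act (E j) (free_act (Ki i) m))"
  and K_F': "free_act (Ki i) (free_act (F j) m) = sM (q powi (- (int (d i) * a i j))) (free_act (F j) (free_act (Ki i) m))"
  using K_E[of i j m] K_F[of i j m] by (simp_all only: qd_powi mult_minus_right)

lemma q_powi_cancel: "sM (q powi n) (sM (q powi (- n)) m) = m" "sM (q powi (- n)) (sM (q powi n) m) = m"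
  using q_nonzero by (simp_all add: power_int_minus)

lemma Kinv_E: "free_act (Kinv i) (free_act (E j) m) = sM (q powi (- (int (d i) * a i j))) (free_act (E j) (free_act (Kinv i) m))"
proof -
  have "free_act (Kinv i) (free_act (Ki i) (free_act (E j) (free_act (Kinv i) m)))
      = sM (q powi (int (d i) * a i j)) (free_act (Kinv i) (free_act (E j) m))"
    by (simp only: K_E' K_Kinv act_simps)
  then have "free_act (E j) (free_act (Kinv i) m) = sM (q powi (int (d i) * a i j)) (free_act (Kinv i) (free_act (E j) m))"
    by (simp only: K_Kinv)
  then show ?thesis by (simp only: q_powi_cancel)
qed

lemma Kinv_F: "free_act (Kinv i) (free_act (F j) m) = sM (q powi (int (d i) * a i j)) (free_act (F j) (free_act (Kinv i) m))"
proof -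
  have "free_act (Kinv i) (free_act (Ki i) (free_act (F j) (free_act (Kinv i) m)))
      = sM (q powi (- (int (d i) * a i j))) (free_act (Kinv i) (free_act (F j) m))"
    by (simp only: K_F' K_Kinv act_simps)
  then have "free_act (F j) (free_act (Kinv i) m) = sM (q powi (- (int (d i) * a i j))) (free_act (Kinv i) (free_act (F j) m))"
    by (simp only: K_Kinv)
  then show ?thesis by (simp only: q_powi_cancel)
qed

abbreviation "k_op i \<equiv> free_act (k_gen J \<tau> i)"
abbreviation "kinv_op i \<equiv> free_act (kinv_gen J \<tau> i)"
abbreviation "B_op j \<equiv> free_act (B_gen a d J \<tau> ws \<sigma> j)"

lemma k_op: "k_op i m = (if i \<in> J then free_act (Ki i) m else free_act (Ki i) (free_act (Kinv (\<tau> i)) m))"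
  by (simp add: k_gen_def free_act_mult)

lemma kinv_op_k_op: "kinv_op i (k_op i m) = m"
  by (simp add: kinv_gen_def k_gen_def free_act_mult K_Kinv)

lemma B_op:
  assumes "j \<in> S"
  shows "B_op j m = free_act (F j) m + sM (\<sigma> j) (free_act (E j) (free_act (Kinv j) m))"
proof -
  have "lusztig a d ws (E j) = E j"
    by (rule lusztig_fixes_E) (use word marked assms in blast)
  then show ?thesis
    using marked(1,4)[OF assms] by (simp add: B_gen_def free_act_simps)
qed

text \<open>
The automorphism \<open>\<tau>\<close> fixes the marked vertex \<open>j\<close>, and \<open>d\<^sub>i a\<^sub>i\<^sub>j\<close> is symmetric. Hence \<open>K\<^sub>i\<close> and
\<open>K\<^bsub>\<tau>(i)\<^esub>\<close> scale \<open>E\<^sub>j\<close> by the same power of \<open>q\<close>, and \<open>k\<^sub>i\<close> commutes with \<open>E\<^sub>j\<close> and \<open>F\<^sub>j\<close>.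
\<close>

lemma torus_weight: "j \<in> S \<Longrightarrow> int (d (\<tau> i)) * a (\<tau> i) j = int (d i) * a i j"
proof -
  assume j: "j \<in> S"
  have "a j (\<tau> i) = a j i" using automorphism[of j i] marked(1)[OF j] by simp
  then show ?thesis by (simp add: d_symmetric[of _ j])
qed

lemma k_op_commutes:
  assumes "j \<in> S"
  shows "k_op i (free_act (E j) m) = free_act (E j) (k_op i m)"
    and "k_op i (free_act (F j) m) = free_act (F j) (k_op i m)"
    and "k_op i (free_act (Kinv j) m) = free_act (Kinv j) (k_op i m)"
  using marked(3)[OF _ assms, of i] torus_weight[OF assms, of i]
  by (auto simp add: k_op K_E' K_F' Kinv_E Kinv_F act_simps q_powi_cancel Kinv_K Kinv_Kinv simp del: scale_scale)

lemma k_op_B_op: "j \<in> S \<Longrightarrow> k_op i (B_op j m) = B_op j (k_op i m)"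
  by (simp add: B_op act_simps k_op_commutes)

lemma k_op_k_op: "k_op i (k_op j m) = k_op j (k_op i m)"
  by (simp add: k_op K_K[of i] Kinv_K Kinv_Kinv[of "\<tau> i"])

lemma B_op_B_op:
  assumes "i \<in> S" "j \<in> S"
  shows "B_op i (B_op j m) = B_op j (B_op i m)"
proof (cases "i = j")
  case False
  then have ij: "a i j = 0" "a j i = 0" "j \<noteq> i" using marked(2) assms by blast+
  have "free_act (E i) (free_act (E j) m) = free_act (E j) (free_act (E i) m)" for m
    using serre_commute[OF False ij(1), of GE] sl2.v_diff_nonzero by blast
  moreover have "free_act (F i) (free_act (F j) m) = free_act (F j) (free_act (F i) m)" for m
    using serre_commute[OF False ij(1), of GF] sl2.v_diff_nonzero by blast
  ultimately show ?thesis
    using False ij assms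
    by (simp add: B_op act_simps Kinv_E Kinv_F E_F_commute Kinv_Kinv[of i] algebra_simps)
qed simp

lemma joint_K_eigenvectors: "jointly_diagonalizable (range (\<lambda>i. free_act (Ki i)))"
proof (rule jointly_diagonalizable_finite)
  show "eigenspan T UNIV = UNIV" if "T \<in> range (\<lambda>i. free_act (Ki i))" for T
    using that sl2.K_diagonalizable eigenspan_mono[OF subset_UNIV] by blast
qed (auto simp: operator_free_act K_K)

text \<open>
The operators \<open>K\<^sub>i\<close> commute and are diagonalizable, so their joint eigenvectors span, and these are
eigenvectors of the products \<open>k\<^sub>i\<close> of operators \<open>K\<^sub>i\<close> and their inverses.
\<close>

lemma k_op_diagonalizable: "eigenspan (k_op i) (range ((powi) q)) = UNIV"
proof -
  have "x \<in> eigenspan (k_op i) (range ((powi) q))" for x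
  proof (rule span_subspace_induct[of x "{x. \<forall>T\<in>range (\<lambda>i. free_act (Ki i)). \<exists>c. T x = sM c x}"])
    show "x \<in> span {x. \<forall>T\<in>range (\<lambda>i. free_act (Ki i)). \<exists>c. T x = sM c x}"
      using joint_K_eigenvectors by (simp add: jointly_diagonalizable_def)
    fix y assume y: "y \<in> {x. \<forall>T\<in>range (\<lambda>i. free_act (Ki i)). \<exists>c. T x = sM c x}"
    show "y \<in> eigenspan (k_op i) (range ((powi) q))"
    proof (cases "y = 0")
      case True
      then show ?thesis using subspace_0[OF subspace_eigenspan] by simp
    next
      case False
      have "\<exists>n. free_act (Ki j) y = sM ((q ^ d j) powi n) y" for j
        using y type_one'[OF False, of j] by fastforce
      then obtain n where n: "free_act (Ki j) y = sM ((q ^ d j) powi n j) y" for j by metis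
      have ninv: "free_act (Kinv j) y = sM ((q ^ d j) powi - n j) y" for j
        using n[of j] sl2.K_weight_iff by blast
      have "k_op i y = sM (q powi (if i \<in> J then int (d i) * n i else int (d i) * n i - int (d (\<tau> i)) * n (\<tau> i))) y"
        using q_nonzero
        by (simp add: k_op n ninv qd_powi act_simps power_int_diff power_int_minus divide_inverse mult.commute)
      then show ?thesis by (rule eigenspan_base) blast
    qed
  qed simp
  then show ?thesis by blast
qed

text \<open>
No \<open>T\<^sub>w\<close> is left in \<open>B\<^sub>j\<close> for marked \<open>j\<close>, so \<open>B\<^sub>j\<close> is the coideal generator of the quantum sl2 at \<open>j\<close>
and has eigenvalues \<open>c [n]\<close> with \<open>c\<^sup>2 = \<sigma>\<^sub>j q\<^sub>j\<close>. Here \<open>c\<close> is regular at \<open>q = 1\<close> since \<open>\<sigma>\<^sub>j\<close> is a unit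
there, and \<open>[n]\<close> is a Laurent polynomial in \<open>q\<^sub>j\<close>.
\<close>

lemma B_op_diagonalizable:
  assumes j: "j \<in> S"
  shows "eigenspan (B_op j) (K1 \<Phi>) = UNIV"
proof -
  \<comment> \<open>\<open>c\<close> is one of the two square roots; the other one has the same spectrum.\<close>
  obtain c where c: "c ^ 2 = \<sigma> j * q ^ d j" using nth_root_exists[of 2 "\<sigma> j * q ^ d j"] by auto
  obtain A where A: "\<Phi> (\<sigma> j * q ^ d j) = to_ac (fps_to_fls A)" "fps_nth A 0 \<noteq> 0"
    using unit_times_q_power_expansion[OF expansion units] marked(4)[OF j] by blast
  have c_K1: "c \<in> K1 \<Phi>" by (rule sqrt_in_K1[OF expansion c A])
  have "\<sigma> j * q ^ d j \<noteq> 0"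
  proof
    assume "\<sigma> j * q ^ d j = 0"
    then have "to_ac (fps_to_fls A) = 0" using A(1) expansion_0[OF expansion] by metis
    then show False using A(2) by simp
  qed
  then have c0: "c \<noteq> 0" using c by auto
  interpret coideal_generator sM "q ^ d j" "free_act (E j)" "free_act (F j)" "free_act (Ki j)"
    "free_act (Kinv j)" "\<sigma> j" c
    by unfold_locales (rule c c0)+
  have qn: "sl2.qnumber j (int n) \<in> K1 \<Phi>" for n
  proof (induction n)
    case (Suc n)
    have "sl2.qnumber j 1 = 1" unfolding sl2.qnumber_def using sl2.v_diff_nonzero by (simp add: power_int_minus)
    then have "sl2.qnumber j (int (Suc n)) = (q ^ d j) powi (- int n) + (q ^ d j) powi 1 * sl2.qnumber j (int n)"
      using sl2.qnumber_split[of j 1 "int (Suc n)"] by (simp add: algebra_simps)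
    also have "\<dots> \<in> K1 \<Phi>"
      unfolding qd_powi by (intro K1_add[OF expansion] K1_mult[OF expansion] q_powi_in_K1[OF expansion] Suc)
    finally show ?case .
  qed (simp add: K1_0[OF expansion])
  have "sl2.qnumber j n \<in> K1 \<Phi>" for n
  proof (cases "n \<ge> 0")
    case True
    then show ?thesis using qn[of "nat n"] by simp
  next
    case False
    have "sl2.qnumber j n = - sl2.qnumber j (int (nat (- n)))"
      using False by (simp add: sl2.qnumber_def minus_divide_left)
    then show ?thesis using K1_minus[OF expansion qn[of "nat (- n)"]] by (simp only:)
  qed
  then have "range (\<lambda>n. c * sl2.qnumber j n) \<subseteq> K1 \<Phi>" using c_K1 K1_mult[OF expansion] by blast
  moreover have "coideal_op = B_op j" by (rule ext) (simp add: coideal_op_def B_op[OF j])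
  ultimately show ?thesis
    using coideal_op_diagonalizable eigenspan_mono by (metis top.extremum_uniqueI)
qed

lemma joint_torus_eigenvectors: "jointly_diagonalizable (range k_op \<union> B_op ` S)"
proof (rule jointly_diagonalizable_finite)
  show "eigenspan T UNIV = UNIV" if T: "T \<in> range k_op \<union> B_op ` S" for T
  proof -
    consider i where "T = k_op i" | j where "j \<in> S" "T = B_op j" using T by blast
    then show ?thesis
      using k_op_diagonalizable B_op_diagonalizable eigenspan_mono[OF subset_UNIV]
      by cases blast+
  qed
  show "R (T x) = T (R x)" if "R \<in> range k_op \<union> B_op ` S" "T \<in> range k_op \<union> B_op ` S" for R T x
    using that k_op_k_op k_op_B_op B_op_B_op by auto
qed (auto simp: operator_free_act)

text \<open>
Acting by scalars on \<open>x\<close> is inherited by sums, products and inverses.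
\<close>

lemma torus_eigenvector:
  assumes x: "\<And>T. T \<in> range k_op \<union> B_op ` S \<Longrightarrow> \<exists>c. T x = sM c x"
    and "u \<in> torus a d J \<tau> ws \<sigma> S"
  shows "\<exists>c. act u x = sM c x"
proof -
  have "act u x \<in> {sM c x | c. True} \<and> u \<in> carrier (quantum_group a d)"
    using assms(2) unfolding torus_def generated_subalgebra_def
  proof (induction rule: generate_ring.induct)
    case one
    have "act \<one>\<^bsub>quantum_group a d\<^esub> x = sM 1 x"
      using free_act_1[of x] by (simp add: free_act_def cls_simps)
    then show ?case using ring.ring_simprules(6)[OF quantum_group_ring] by blast
  next
    case (incl h)
    then obtain y where y: "h = cls a d y"
      "y \<in> range scal \<union> (range (k_gen J \<tau>) \<union> range (kinv_gen J \<tau>) \<union> B_gen a d J \<tau> ws \<sigma> ` S)" by blast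
    have "\<exists>c. free_act y x = sM c x"
    proof -
      consider c where "y = scal c" | i where "y = k_gen J \<tau> i" | i where "y = kinv_gen J \<tau> i"
        | j where "j \<in> S" "y = B_gen a d J \<tau> ws \<sigma> j" using y(2) by blast
      then show ?thesis
      proof cases
        case 3
        obtain c where "k_op i x = sM c x" using x by blast
        then have inv: "x = sM c (kinv_op i x)" using kinv_op_k_op[of i x] by (simp add: act_simps)
        have "kinv_op i x = sM (1 / c) x"
        proof (cases "c = 0")
          case True
          then show ?thesis using inv act_simps(4) by (metis scale_zero_left scale_zero_right)
        next
          case False
          have "sM (1 / c) x = sM (1 / c) (sM c (kinv_op i x))" using inv by (rule arg_cong)
          then show ?thesis using False by simp
        qed
        then show ?thesis unfolding 3 by blast
      qed (use x free_act_scal in auto)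
    qed
    then show ?case using y(1) cls_simps(1) by (auto simp: free_act_def)
  next
    case (a_inv h)
    then obtain y c where h: "h = cls a d y" "act h x = sM c x" using cls_surj by blast
    have "cls a d (- y) = \<ominus>\<^bsub>quantum_group a d\<^esub> h"
    proof -
      have "cls a d (- y) \<oplus>\<^bsub>quantum_group a d\<^esub> cls a d y = \<zero>\<^bsub>quantum_group a d\<^esub>"
        using ring_hom_zero[OF cls_ring_hom ring_of_type_ring_1 quantum_group_ring, of a d]
        by (simp add: cls_simps(3)[symmetric] ring_of_type_algebra_simps)
      then show ?thesis
        using abelian_group.minus_equality[OF ring.is_abelian_group[OF quantum_group_ring]] h(1) cls_simps(1)
        by metis
    qed
    moreover have "free_act (- y) x = sM (- c) x"
      using h by (simp add: free_act_minus) (simp add: free_act_def)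
    ultimately have "act (\<ominus>\<^bsub>quantum_group a d\<^esub> h) x = sM (- c) x" by (simp only: free_act_def)
    then show ?case using ring.ring_simprules(3)[OF quantum_group_ring] a_inv by blast
  next
    case (eng_add h1 h2)
    then obtain c1 c2 where c: "act h1 x = sM c1 x" "act h2 x = sM c2 x" by blast
    have "act (h1 \<oplus>\<^bsub>quantum_group a d\<^esub> h2) x = sM (c1 + c2) x"
      using eng_add module c by (simp add: U_module_def algebra_module_def scale_left_distrib)
    then show ?case using eng_add ring.ring_simprules(1)[OF quantum_group_ring] by blast
  next
    case (eng_mult h1 h2)
    then obtain c1 c2 where c: "act h1 x = sM c1 x" "act h2 x = sM c2 x" by blast
    have "act (h1 \<otimes>\<^bsub>quantum_group a d\<^esub> h2) x = act h1 (act h2 x)"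
      using eng_mult module by (simp add: U_module_def algebra_module_def)
    also have "\<dots> = sM (c2 * c1) x"
      using eng_mult c operator_simps(5)[OF operator_act] by simp
    finally show ?case using eng_mult ring.ring_simprules(5)[OF quantum_group_ring] by blast
  qed
  then show ?thesis by blast
qed

lemma classical_weight_module: "classical_weight_module a d J \<tau> ws \<sigma> S \<Phi> sM act"
  unfolding classical_weight_module_def
proof (intro conjI allI impI)
  have "carrier (iquantum_group a d J \<tau> ws \<sigma>) \<subseteq> carrier (quantum_group a d)"
    by (simp add: iquantum_group_def generated_subalgebra_subset_carrier)
  then show "algebra_module (iquantum_group a d J \<tau> ws \<sigma>) (\<lambda>c. cls a d (scal c)) sM act"
    using module unfolding U_module_def algebra_module_def
    by (auto simp: iquantum_group_def subset_iff)
  show "span (\<Union>\<chi>. simultaneous_eigenspace sM act (torus a d J \<tau> ws \<sigma> S) \<chi>) = UNIV"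
  proof -
    have "{x. \<forall>T\<in>range k_op \<union> B_op ` S. \<exists>c. T x = sM c x}
        \<subseteq> (\<Union>\<chi>. simultaneous_eigenspace sM act (torus a d J \<tau> ws \<sigma> S) \<chi>)"
    proof
      fix x assume "x \<in> {x. \<forall>T\<in>range k_op \<union> B_op ` S. \<exists>c. T x = sM c x}"
      then have "\<forall>u\<in>torus a d J \<tau> ws \<sigma> S. \<exists>c. act u x = sM c x"
        using torus_eigenvector by blast
      then show "x \<in> (\<Union>\<chi>. simultaneous_eigenspace sM act (torus a d J \<tau> ws \<sigma> S) \<chi>)"
        unfolding simultaneous_eigenspace_def by (auto dest!: bchoice)
    qed
    then show ?thesis
      using joint_torus_eigenvectors span_mono unfolding jointly_diagonalizable_def by blast
  qed
next
  fix i c m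
  assume *: "i \<notin> S \<and> m \<noteq> 0 \<and> act (cls a d (qshift (q ^ d i) 0 (k_gen J \<tau> i))) m = sM c m"
  have q1: "q ^ d i - 1 \<noteq> 0" using q_generic[OF expansion, of "d i"] d_pos[of i] by auto
  have "sM c m = free_act (qshift (q ^ d i) 0 (k_gen J \<tau> i)) m" using * by (simp add: free_act_def)
  also have "\<dots> = sM (1 / (q ^ d i - 1)) (k_op i m - m)"
    by (simp add: qshift_def free_act_simps)
  finally have "sM (q ^ d i - 1) (sM c m) = k_op i m - m" using q1 by simp
  then have "k_op i m = sM ((q ^ d i - 1) * c + 1) m" by (simp add: scale_left_distrib)
  then have "(q ^ d i - 1) * c + 1 \<in> range ((powi) q)"
    using eigenvalue_of_eigenspan[OF operator_free_act k_op_diagonalizable] * by blast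
  then obtain n where "(q ^ d i - 1) * c + 1 = q powi n" by blast
  then have "c = (q powi n - 1) / (q ^ d i - 1)" using q1 by (simp add: field_simps)
  then show "c \<in> K1 \<Phi>" using q_quotient_in_K1[OF expansion d_pos] by simp
next
  fix j c m
  assume *: "j \<in> S \<and> m \<noteq> 0 \<and> act (cls a d (B_gen a d J \<tau> ws \<sigma> j)) m = sM c m"
  then show "c \<in> K1 \<Phi>"
    using eigenvalue_of_eigenspan[OF operator_free_act B_op_diagonalizable] by (auto simp: free_act_def)
qed

end

theorem proposition3p1p4:
  fixes a :: "'i::finite \<Rightarrow> 'i \<Rightarrow> int" and d :: "'i \<Rightarrow> nat"
    and I_black I_marked :: "'i set" and \<tau> :: "'i \<Rightarrow> 'i" and ws :: "'i list"
    and \<Phi> :: "K \<Rightarrow> complex fls alg_closure" and \<sigma> :: "'i \<Rightarrow> K"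
    and sg :: "complex \<Rightarrow> 'g::ab_group_add \<Rightarrow> 'g" and br :: "'g \<Rightarrow> 'g \<Rightarrow> 'g"
    and e f h :: "'i \<Rightarrow> 'g" and \<theta> :: "'g \<Rightarrow> 'g" and \<Gamma> :: "('i \<Rightarrow> int) set"
    and sM :: "K \<Rightarrow> 'm::ab_group_add \<Rightarrow> 'm" and act :: "'i free_alg set \<Rightarrow> 'm \<Rightarrow> 'm"
  assumes "expansion_at_one \<Phi>"
    and "cartan_matrix a d"
    and "semisimple_lie_algebra sg br"
    and "chevalley_generators a sg br e f h"
    and "satake_diagram a I_black \<tau> ws"
    and "parameter a I_black \<tau> ws \<Phi> \<sigma>"
    and "satake_involution a I_black \<tau> ws sg br e f h \<theta>"
    and "marking_roots a sg br h \<theta> \<Gamma>"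
    and "I_marked = marked_vertices \<Gamma>"
    and "admissible_marking a I_black \<tau> I_marked"
    and "U_module a d sM act"
    and "finite_dim sM (UNIV :: 'm set)"
    and "type_one a d sM act"
  shows "in_category_C' a d I_black \<tau> ws \<sigma> I_marked \<Phi> sM act"
proof -
  have vs: "vector_space sM" using assms(11) by (simp add: U_module_def algebra_module_def)
  obtain B where B: "finite B" "UNIV \<subseteq> module.span sM B" using assms(12) by (auto simp: finite_dim_def)
  interpret symmetric_pair_module a d sM act I_black I_marked \<tau> ws \<Phi> \<sigma>
  proof (intro symmetric_pair_module.intro symmetric_pair_module_axioms.intro quantum_group_module.intro
      quantum_group_module_axioms.intro finite_dim_operator_space.intro operator_space.intro
      finite_dim_operator_space_axioms.intro vs assms)
    show "\<exists>B. finite B \<and> module.span sM B = UNIV" using B by blast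
  qed (use assms(2,5,6) in \<open>auto simp: cartan_matrix_def satake_diagram_def longest_word_def parameter_def\<close>)
  have "finite_dim sM (simultaneous_eigenspace sM act T \<chi>)" for T \<chi>
    using assms(12) unfolding finite_dim_def by blast
  then show ?thesis using classical_weight_module by (simp add: in_category_C'_def)
qed

end
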